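(* Every separable complete uniform space is the limit of an inverse spectrum (indexed by a directed set, in the category of uniform spaces and uniformly continuous maps) of uniform polyhedra and uniformly continuous maps.
   Context: Uniform spaces are assumed Hausdorff (they need not be metrizable here); separable means having a countable dense subset. Geometric realization: for a poset $P$, let $[0,1]^P$ be the set of all functions $P\to[0,1]$ with the metric $d(f,g)=\sup_{s\in P}|f(s)-g(s)|$. Each $p\in P$ is identified with the characteristic function of $\{q\in P: q\le p\}$. Then $|P|\subset[0,1]^P$ is the union of the convex hulls of all nonempty finite chains of $P$, with the induced uniformity. A poset is conditionally complete if every nonempty subset that has an upper bound has a least upper bound. A uniform polyhedron is the geometric realization of a countable conditionally complete poset. *)

theory Defs
  imports "HOL-Analysis.Analysis"
begin

section \<open>Geometric realization of posets and uniform polyhedra\<close>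

text \<open>
  A poset is a carrier \<open>P\<close> with a relation \<open>r\<close> such that \<^term>\<open>partial_order_on P r\<close>;
  \<^term>\<open>(x, y) \<in> r\<close> is read as \<open>x \<le> y\<close>.
\<close>

definition conditionally_complete :: "'p set \<Rightarrow> ('p \<times> 'p) set \<Rightarrow> bool" where
  "conditionally_complete P r \<longleftrightarrow>
     (\<forall>A. A \<subseteq> P \<and> A \<noteq> {} \<and> (\<exists>u\<in>P. \<forall>a\<in>A. (a, u) \<in> r) \<longrightarrow>
       (\<exists>s\<in>P. (\<forall>a\<in>A. (a, s) \<in> r) \<and> (\<forall>u\<in>P. (\<forall>a\<in>A. (a, u) \<in> r) \<longrightarrow> (s, u) \<in> r)))"

text \<open>
  A function \<open>P \<rightarrow> [0,1]\<close> is represented by its extension by zero to the whole (discrete) type,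
  as an element of the space of bounded continuous functions with the supremum metric.
  Since both functions vanish off \<open>P\<close>, that supremum is the supremum over \<open>P\<close>
  (lemma \<open>dist_geometric_realization\<close> below).
\<close>

definition poset_vertex ::
  "'p set \<Rightarrow> ('p \<times> 'p) set \<Rightarrow> 'p \<Rightarrow> ('p::discrete_topology \<Rightarrow>\<^sub>C real)" where
  "poset_vertex P r p = Bcontfun (indicator {q \<in> P. (q, p) \<in> r})"

lemma apply_poset_vertex: "apply_bcontfun (poset_vertex P r p) = indicator {q \<in> P. (q, p) \<in> r}"
proof -
  have "range (indicator {q \<in> P. (q, p) \<in> r} :: 'a \<Rightarrow> real) \<subseteq> {0, 1}"
    by (auto simp: indicator_def)
  then have "bounded (range (indicator {q \<in> P. (q, p) \<in> r} :: 'a \<Rightarrow> real))"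
    by (rule bounded_subset[rotated]) auto
  then have "indicator {q \<in> P. (q, p) \<in> r} \<in> (bcontfun :: ('a \<Rightarrow> real) set)"
    by (simp add: bcontfun_def)
  then show ?thesis
    by (simp add: poset_vertex_def Bcontfun_inverse)
qed

definition geometric_realization ::
  "'p set \<Rightarrow> ('p \<times> 'p) set \<Rightarrow> ('p::discrete_topology \<Rightarrow>\<^sub>C real) set" where
  "geometric_realization P r =
     (\<Union>C \<in> {C. C \<subseteq> P \<and> finite C \<and> C \<noteq> {} \<and> C \<in> Chains r}. convex hull (poset_vertex P r ` C))"

text \<open>
  Every countable poset is isomorphic to one with carrier a set of natural numbers, and
  isomorphic posets have isometric realizations; so subsets of \<^typ>\<open>nat \<Rightarrow>\<^sub>C real\<close> suffice to
  represent all uniform polyhedra.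
\<close>

definition uniform_polyhedron :: "('p::discrete_topology \<Rightarrow>\<^sub>C real) set \<Rightarrow> bool" where
  "uniform_polyhedron K \<longleftrightarrow>
     (\<exists>P r. countable P \<and> partial_order_on P r \<and> conditionally_complete P r \<and>
            K = geometric_realization P r)"

lemma geometric_realization_values:
  assumes "f \<in> geometric_realization P r"
  shows "apply_bcontfun f s \<in> {0..1}" and "s \<notin> P \<Longrightarrow> apply_bcontfun f s = 0"
proof -
  let ?B = "{g :: 'a \<Rightarrow>\<^sub>C real. apply_bcontfun g s \<in> {0..1} \<and> (s \<notin> P \<longrightarrow> apply_bcontfun g s = 0)}"
  have "convex ?B"
    by (rule convexI) (auto intro: convex_bound_le add_nonneg_nonneg)
  moreover have "poset_vertex P r p \<in> ?B" for p
    by (auto simp: apply_poset_vertex indicator_def)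
  ultimately have "convex hull (poset_vertex P r ` C) \<subseteq> ?B" for C
    by (intro hull_minimal) auto
  then have "f \<in> ?B"
    using assms unfolding geometric_realization_def by blast
  then show "apply_bcontfun f s \<in> {0..1}" "s \<notin> P \<Longrightarrow> apply_bcontfun f s = 0"
    by auto
qed

lemma dist_geometric_realization:
  assumes f: "f \<in> geometric_realization P r" and g: "g \<in> geometric_realization P r"
  shows "dist f g = (SUP s\<in>P. \<bar>apply_bcontfun f s - apply_bcontfun g s\<bar>)"
proof (rule antisym)
  have ne: "P \<noteq> {}"
    using f by (auto simp: geometric_realization_def)
  have le: "\<bar>apply_bcontfun f s - apply_bcontfun g s\<bar> \<le> dist f g" for s
    using dist_bounded[of f s g] by (simp add: dist_real_def)
  then have bdd: "bdd_above ((\<lambda>s. \<bar>apply_bcontfun f s - apply_bcontfun g s\<bar>) ` P)"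
    by (intro bdd_aboveI2)
  obtain t where t: "t \<in> P"
    using ne by blast
  show "dist f g \<le> (SUP s\<in>P. \<bar>apply_bcontfun f s - apply_bcontfun g s\<bar>)"
  proof (rule dist_bound)
    fix s
    show "dist (apply_bcontfun f s) (apply_bcontfun g s)
            \<le> (SUP s\<in>P. \<bar>apply_bcontfun f s - apply_bcontfun g s\<bar>)"
    proof (cases "s \<in> P")
      case True
      then show ?thesis
        using cSUP_upper[OF _ bdd] by (simp add: dist_real_def)
    next
      case False
      have "0 \<le> (SUP s\<in>P. \<bar>apply_bcontfun f s - apply_bcontfun g s\<bar>)"
        using cSUP_upper[OF t bdd] by linarith
      with False show ?thesis
        using geometric_realization_values(2) f g by (metis dist_self)
    qed
  qed
  show "(SUP s\<in>P. \<bar>apply_bcontfun f s - apply_bcontfun g s\<bar>) \<le> dist f g"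
    using ne le by (intro cSUP_least)
qed


section \<open>Inverse spectra of uniform spaces and their limits\<close>

text \<open>
  The limit lives in a function type that carries no \<^class>\<open>uniform_space\<close> structure, so maps
  into and out of it are described by explicit carriers \<open>X\<close> and entourage filters \<open>U\<close> on
  \<open>X \<times> X\<close>. A subset \<open>X\<close> of a type of class \<^class>\<open>uniform_space\<close> carries \<^term>\<open>uniformity_on X\<close>.
\<close>

definition uniform_map ::
  "'a set \<Rightarrow> ('a \<times> 'a) filter \<Rightarrow> 'b set \<Rightarrow> ('b \<times> 'b) filter \<Rightarrow> ('a \<Rightarrow> 'b) \<Rightarrow> bool" where
  "uniform_map X U Y V f \<longleftrightarrow> f \<in> X \<rightarrow> Y \<and> (LIM (x, y) U. (f x, f y) :> V)"

definition uniformly_homeomorphic ::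
  "'a set \<Rightarrow> ('a \<times> 'a) filter \<Rightarrow> 'b set \<Rightarrow> ('b \<times> 'b) filter \<Rightarrow> bool" where
  "uniformly_homeomorphic X U Y V \<longleftrightarrow>
     (\<exists>f g. uniform_map X U Y V f \<and> uniform_map Y V X U g \<and>
            (\<forall>x\<in>X. g (f x) = x) \<and> (\<forall>y\<in>Y. f (g y) = y))"

definition directed_set :: "'i set \<Rightarrow> ('i \<times> 'i) set \<Rightarrow> bool" where
  "directed_set I R \<longleftrightarrow>
     I \<noteq> {} \<and> preorder_on I R \<and> (\<forall>i\<in>I. \<forall>j\<in>I. \<exists>k\<in>I. (i, k) \<in> R \<and> (j, k) \<in> R)"

text \<open>
  For \<open>i \<le> j\<close> the bonding map \<open>p i j\<close> goes from \<open>X j\<close> to \<open>X i\<close>.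
  The type of indices cannot be quantified inside a formula. To assert that a space in a type
  \<open>'a\<close> is the limit of some spectrum, one has to fix a sufficiently large index type; indexing by
  pairs of a set of maps \<open>'a \<Rightarrow> nat \<Rightarrow> real\<close> and a natural number allows index sets of
  cardinality at least two to the power of the continuum.
\<close>

definition inverse_spectrum ::
  "'i set \<Rightarrow> ('i \<times> 'i) set \<Rightarrow> ('i \<Rightarrow> 'b::uniform_space set) \<Rightarrow> ('i \<Rightarrow> 'i \<Rightarrow> 'b \<Rightarrow> 'b) \<Rightarrow> bool" where
  "inverse_spectrum I R X p \<longleftrightarrow>
     directed_set I R \<and>
     (\<forall>(i, j)\<in>R. p i j \<in> X j \<rightarrow> X i \<and> uniformly_continuous_on (X j) (p i j)) \<and>
     (\<forall>i\<in>I. \<forall>x\<in>X i. p i i x = x) \<and>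
     (\<forall>i j k. (i, j) \<in> R \<and> (j, k) \<in> R \<longrightarrow> (\<forall>x\<in>X k. p i j (p j k x) = p i k x))"

text \<open>The limit: the space of threads, with the uniformity induced from the product.\<close>

definition spectrum_limit ::
  "'i set \<Rightarrow> ('i \<times> 'i) set \<Rightarrow> ('i \<Rightarrow> 'b set) \<Rightarrow> ('i \<Rightarrow> 'i \<Rightarrow> 'b \<Rightarrow> 'b) \<Rightarrow> ('i \<Rightarrow> 'b) set" where
  "spectrum_limit I R X p = {x \<in> Pi\<^sub>E I X. \<forall>(i, j)\<in>R. p i j (x j) = x i}"

definition spectrum_limit_uniformity ::
  "'i set \<Rightarrow> ('i \<times> 'i) set \<Rightarrow> ('i \<Rightarrow> 'b::uniform_space set) \<Rightarrow> ('i \<Rightarrow> 'i \<Rightarrow> 'b \<Rightarrow> 'b) \<Rightarrow>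
   (('i \<Rightarrow> 'b) \<times> ('i \<Rightarrow> 'b)) filter" where
  "spectrum_limit_uniformity I R X p =
     inf (INF i\<in>I. filtercomap (\<lambda>(x, y). (x i, y i)) (uniformity_on (X i)))
         (principal (spectrum_limit I R X p \<times> spectrum_limit I R X p))"

text \<open>
  The following three lemmas are the universal property of the limit: the projections are
  uniformly continuous and commute with the bonding maps, and every compatible family of
  uniformly continuous maps factors uniquely through them.
\<close>

lemma spectrum_limit_projection:
  assumes "i \<in> I"
  shows "uniform_map (spectrum_limit I R X p) (spectrum_limit_uniformity I R X p)
           (X i) (uniformity_on (X i)) (\<lambda>x. x i)"
proof -
  have "spectrum_limit_uniformity I R X p
          \<le> filtercomap (\<lambda>(x, y). (x i, y i)) (uniformity_on (X i))"
    unfolding spectrum_limit_uniformity_def using assms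
    by (intro le_infI1 INF_lower)
  then have "LIM (x, y) spectrum_limit_uniformity I R X p. (x i, y i) :> uniformity_on (X i)"
    by (simp add: filterlim_iff_le_filtercomap)
  then show ?thesis
    using assms unfolding uniform_map_def by (auto simp: spectrum_limit_def)
qed

lemma spectrum_limit_projection_compatible:
  assumes "x \<in> spectrum_limit I R X p" and "(i, j) \<in> R"
  shows "p i j (x j) = x i"
  using assms by (auto simp: spectrum_limit_def)

lemma spectrum_limit_universal:
  assumes W: "W \<le> principal (Z \<times> Z)"
    and R: "R \<subseteq> I \<times> I"
    and h: "\<And>i. i \<in> I \<Longrightarrow> uniform_map Z W (X i) (uniformity_on (X i)) (h i)"
    and compat: "\<And>i j z. (i, j) \<in> R \<Longrightarrow> z \<in> Z \<Longrightarrow> p i j (h j z) = h i z"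
  shows "uniform_map Z W (spectrum_limit I R X p) (spectrum_limit_uniformity I R X p)
           (\<lambda>z. \<lambda>i\<in>I. h i z)"
    and "\<And>u z. u \<in> Z \<rightarrow> spectrum_limit I R X p \<Longrightarrow> (\<And>i z. i \<in> I \<Longrightarrow> z \<in> Z \<Longrightarrow> u z i = h i z)
           \<Longrightarrow> z \<in> Z \<Longrightarrow> u z = (\<lambda>i\<in>I. h i z)"
proof -
  let ?u = "\<lambda>z. \<lambda>i\<in>I. h i z" and ?L = "spectrum_limit I R X p"
  have in_L: "?u z \<in> ?L" if "z \<in> Z" for z
  proof -
    have "p i j (?u z j) = ?u z i" if "(i, j) \<in> R" for i j
      using that R compat[OF that \<open>z \<in> Z\<close>] by auto
    moreover have "?u z \<in> Pi\<^sub>E I X"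
      using h \<open>z \<in> Z\<close> by (auto simp: uniform_map_def)
    ultimately show ?thesis
      unfolding spectrum_limit_def by blast
  qed
  have "filterlim (\<lambda>(x, y). (?u x, ?u y))
          (filtercomap (\<lambda>(x, y). (x i, y i)) (uniformity_on (X i))) W" if "i \<in> I" for i
  proof -
    have "LIM (x, y) W. (h i x, h i y) :> uniformity_on (X i)"
      using h[OF that] by (simp add: uniform_map_def)
    then show ?thesis
      using that by (simp add: filterlim_filtercomap_iff o_def case_prod_unfold)
  qed
  moreover have "filterlim (\<lambda>(x, y). (?u x, ?u y)) (principal (?L \<times> ?L)) W"
    unfolding filterlim_principal using W in_L
    by (auto simp: le_principal elim!: eventually_mono)
  ultimately have "LIM (x, y) W. (?u x, ?u y) :> spectrum_limit_uniformity I R X p"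
    unfolding spectrum_limit_uniformity_def by (simp add: filterlim_inf filterlim_INF)
  then show "uniform_map Z W ?L (spectrum_limit_uniformity I R X p) ?u"
    using in_L by (auto simp: uniform_map_def)
next
  fix u z
  assume u: "u \<in> Z \<rightarrow> spectrum_limit I R X p"
    and eq: "\<And>i z. i \<in> I \<Longrightarrow> z \<in> Z \<Longrightarrow> u z i = h i z" and z: "z \<in> Z"
  have "u z \<in> extensional I"
    using u z by (auto simp: spectrum_limit_def PiE_def)
  then show "u z = (\<lambda>i\<in>I. h i z)"
    using eq z by (auto simp: fun_eq_iff extensional_def)
qed

end

theory Submission
  imports Defs
begin

text \<open>
  A separable uniform space has enough uniformly continuous maps into the space \<open>c\<^sub>0\<^sub>0\<close> of finitely
  supported sequences to separate points from the complements of entourages: a uniformly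
  continuous pseudometric admits countable point-finite uniform covers of arbitrarily small mesh,
  and these have Lipschitz subordinated functions. For a finite set \<open>F\<close> of such maps and \<open>n \<in> \<nat>\<close>,
  consider the union of all cubes of the grid of mesh \<open>2 / 2\<^sup>n\<close> in \<open>c\<^sub>0\<^sub>0\<^sup>F\<close> whose relative interior
  meets the image of \<open>S\<close>.
  These neighbourhoods of the image, with inclusions followed by coordinate projections as bonding
  maps, form an inverse spectrum whose limit is the closure of the image of \<open>S\<close> in the
  product, hence \<open>S\<close> itself by completeness. Each of them is a uniform polyhedron: the half-line is
  the realization of the fence \<open>0 < 1 > 2 < 3 > \<dots>\<close>, where even numbers are the vertices and odd
  numbers the edges, and a cubical complex is the realization of its face poset, which is a down-set
  in a power of the fence.
\<close>

section \<open>The fence and the half-line\<close>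

text \<open>The covers used are point-finite without a bound on their order, so the complexes may be
  infinite-dimensional. Finite support keeps the set of cubes countable, and the supremum metric
  keeps dimension out of the estimates: each coordinate enters with Lipschitz constant 1 and is
  recovered with constant 3, whatever the number of coordinates. Nerves of covers would give bonding
  maps that commute only up to contiguity. Here all stages lie in one coordinate space, so
  restrictions of coordinates compose exactly; halving the mesh subdivides the grid, which puts a
  finer neighbourhood inside a coarser one. The fence begins with a vertex at 0, so a zero
  coordinate is a degenerate factor of a cube and passing to a face cannot enlarge the support. The
  space need not be metrizable, so a thread determines its point through a Cauchy filter rather than
  a sequence.\<close>

definition fence_le :: "nat \<Rightarrow> nat \<Rightarrow> bool" where
  "fence_le m p \<longleftrightarrow> m = p \<or> even m \<and> (p = Suc m \<or> m = Suc p)"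

text \<open>
  Sending \<open>t\<close> to the function \<open>m \<mapsto> hat m t\<close> identifies the half-line with the realization of the fence.
\<close>

definition hat :: "nat \<Rightarrow> real \<Rightarrow> real" where
  "hat m t = (if even m then min 1 (max 0 (2 - \<bar>t - real m\<bar>)) else max 0 (1 - \<bar>t - real m\<bar>))"

lemma fence_le_refl [simp]: "fence_le m m"
  by (simp add: fence_le_def)

lemma fence_le_trans: "fence_le m n \<Longrightarrow> fence_le n p \<Longrightarrow> fence_le m p"
  by (auto simp: fence_le_def)

lemma fence_le_antisym: "fence_le m n \<Longrightarrow> fence_le n m \<Longrightarrow> m = n"
  by (auto simp: fence_le_def)

lemma fence_le_0_iff [simp]: "fence_le m 0 \<longleftrightarrow> m = 0"
  by (auto simp: fence_le_def)

text \<open>Two distinct vertices lie on at most one common edge, and an edge lies below itself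
  only. Conditional completeness of the face posets rests on this.\<close>

lemma fence_bound_unique:
  assumes "fence_le a u" "fence_le b u" "fence_le a v" "fence_le b v" "a \<noteq> b"
  shows "u = v"
proof (cases "even a \<and> even b")
  case True
  then have "u = Suc a \<or> a = Suc u" "u = Suc b \<or> b = Suc u" "v = Suc a \<or> a = Suc v" "v = Suc b \<or> b = Suc v"
    using assms unfolding fence_le_def by (metis even_Suc)+
  then show ?thesis using \<open>a \<noteq> b\<close> by linarith
next
  case False
  then show ?thesis using assms unfolding fence_le_def by metis
qed

lemma hat_nonneg: "0 \<le> hat m t" and hat_le_1: "hat m t \<le> 1"
  by (auto simp: hat_def)

lemma hat_self [simp]: "hat m (real m) = 1"
  by (simp add: hat_def)

lemma hat_antimono: "fence_le m p \<Longrightarrow> hat p t \<le> hat m t"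
  by (auto simp: fence_le_def hat_def)

lemma hat_lipschitz: "\<bar>hat m s - hat m t\<bar> \<le> \<bar>s - t\<bar>"
  by (auto simp: hat_def max_def min_def abs_if)

lemma hat_pos_imp_dist: "0 < hat m t \<Longrightarrow> \<bar>t - real m\<bar> < 2"
  by (auto simp: hat_def split: if_splits)

lemma even_floor_obtain:
  assumes "0 \<le> (t::real)"
  obtains k :: nat where "2 * real k \<le> t" "t < 2 * real k + 2"
proof -
  have "0 \<le> \<lfloor>t / 2\<rfloor>" using assms by simp
  then have "2 * real (nat \<lfloor>t / 2\<rfloor>) \<le> t" "t < 2 * real (nat \<lfloor>t / 2\<rfloor>) + 2"
    using floor_correct[of "t/2"] by (simp_all add: of_nat_nat field_simps)
  then show ?thesis by (rule that)
qed

lemma hat_near: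
  assumes "2 * real k \<le> t" "t < 2 * real k + 2" "0 < hat m t"
  shows "m = 2 * k \<or> m = Suc (2 * k) \<or> m = Suc (Suc (2 * k))"
proof (cases "even m")
  case True
  then obtain j where j: "m = 2 * j" by (elim evenE)
  have "\<bar>t - 2 * real j\<bar> < 2" using assms(3) j by (auto simp: hat_def split: if_splits)
  then have "real k < real j + 1" "real j < real k + 2" using assms by linarith+
  then have "k < j + 1" "j < k + 2" by linarith+
  then show ?thesis using j by linarith
next
  case False
  then obtain j where j: "m = 2 * j + 1" by (elim oddE)
  have "\<bar>t - 2 * real j - 1\<bar> < 1" using assms(3) j by (auto simp: hat_def split: if_splits)
  then have "real k < real j + 1" "real j < real k + 1" using assms by linarith+
  then have "k < j + 1" "j < k + 1" by linarith+
  then show ?thesis using j by linarith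
qed

text \<open>A point of a realization is a mixture of indicators of principal down-sets along a
  chain, so its superlevel sets at levels in (0,1] have to be principal; for the half-line this is
  checked directly.\<close>

lemma hat_superlevel_principal:
  assumes t: "0 \<le> t" and u: "0 < u" "u \<le> 1"
  shows "\<exists>p. \<forall>m. u \<le> hat m t \<longleftrightarrow> fence_le m p"
proof -
  obtain k where k: "2 * real k \<le> t" "t < 2 * real k + 2"
    using even_floor_obtain[OF t] by blast
  \<comment> \<open>The nearer endpoint of the edge has value 1 and the farther one has the same
    value as the edge. So if the edge misses the level, only the nearer endpoint reaches it.\<close>
  define p where "p = (if u \<le> hat (Suc (2*k)) t then Suc (2*k)
    else if t < 2 * real k + 1 then 2 * k else Suc (Suc (2 * k)))"
  have "u \<le> hat m t \<longleftrightarrow> fence_le m p" for m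
  proof (cases "m = 2 * k \<or> m = Suc (2 * k) \<or> m = Suc (Suc (2 * k))")
    case True
    then show ?thesis using k u
      by (elim disjE) (auto simp: hat_def fence_le_def p_def)
  next
    case False
    then have "\<not> 0 < hat m t" using hat_near k by blast
    moreover have "\<not> fence_le m p"
      using False even_Suc[of m] even_Suc[of "Suc (Suc (2 * k))"]
      unfolding fence_le_def p_def by (auto split: if_splits) (metis dvd_triv_left even_Suc)
    ultimately show ?thesis using u by simp
  qed
  then show ?thesis by blast
qed

lemma finite_hat_values:
  assumes "0 \<le> t"
  shows "finite (range (\<lambda>m. hat m t))"
proof -
  obtain k where k: "2 * real k \<le> t" "t < 2 * real k + 2"
    using even_floor_obtain[OF assms] by blast
  have "range (\<lambda>m. hat m t) \<subseteq> insert 0 ((\<lambda>m. hat m t) ` {2 * k, Suc (2 * k), Suc (Suc (2 * k))})"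
    using hat_near[OF k] hat_nonneg[of _ t] by (auto simp: less_le)
  then show ?thesis by (rule finite_subset) auto
qed

lemma hat_eq_1_exists:
  assumes "0 \<le> t"
  shows "\<exists>m. hat m t = 1"
proof -
  obtain p where "\<forall>m. 1 \<le> hat m t \<longleftrightarrow> fence_le m p"
    using hat_superlevel_principal[OF assms, of 1] by auto
  then have "1 \<le> hat p t" by simp
  then have "hat p t = 1" using hat_le_1[of p t] by linarith
  then show ?thesis by blast
qed

section \<open>Recovering a point of the half-line from its hats\<close>

lemma tent_pair_inverse:
  fixes a b d :: real
  assumes a: "\<bar>a\<bar> \<le> 1" and b: "\<bar>b\<bar> \<le> 1 + d" and d: "d < 1/2"
    and right: "\<bar>max 0 (1 - \<bar>a - 1\<bar>) - max 0 (1 - \<bar>b - 1\<bar>)\<bar> \<le> d"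
    and left: "\<bar>max 0 (1 - \<bar>a + 1\<bar>) - max 0 (1 - \<bar>b + 1\<bar>)\<bar> \<le> d"
  shows "\<bar>a - b\<bar> \<le> 3 * d"
proof -
  have P: "max 0 (1 - \<bar>z - 1\<bar>) = max 0 z" if "z \<le> 1" for z :: real
    using that by auto
  have L: "max 0 (1 - \<bar>z + 1\<bar>) = max 0 (- z)" if "- 1 \<le> z" for z :: real
    using that by auto
  have Pa: "max 0 (1 - \<bar>a - 1\<bar>) = max 0 a" and La: "max 0 (1 - \<bar>a + 1\<bar>) = max 0 (- a)"
    using a by (simp_all add: P L abs_le_iff)
  \<comment> \<open>For displacements up to 1 from an even number, the tents at its odd neighbours
    are the positive and negative parts. Beyond 1 a tent folds back to
    \<open>2 - \<bar>b\<bar>\<close>: then \<open>\<bar>b\<bar>\<close> exceeds 1 by at most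
    \<open>d\<close>, while \<open>d < 1/2\<close> forces \<open>a\<close> to the same side with
    \<open>1 - 2 * d \<le> \<bar>a\<bar>\<close>. These two outer cases give the constant 3.\<close>
  consider "b \<le> - 1" | "- 1 \<le> b" "b \<le> 1" | "1 \<le> b" by linarith
  then show ?thesis
  proof cases
    case 1
    then have "max 0 (1 - \<bar>b + 1\<bar>) = 2 + b" using b d by auto
    then have "\<bar>max 0 (- a) - (2 + b)\<bar> \<le> d" using left unfolding La by simp
    then show ?thesis using 1 a b d unfolding max_def by (simp add: abs_le_iff split: if_splits)
  next
    case 2
    then have "\<bar>max 0 a - max 0 b\<bar> \<le> d" "\<bar>max 0 (- a) - max 0 (- b)\<bar> \<le> d"
      using left right unfolding La Pa by (simp_all add: P L)
    then show ?thesis unfolding max_def by (simp add: abs_le_iff split: if_splits)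
  next
    case 3
    then have "max 0 (1 - \<bar>b - 1\<bar>) = 2 - b" using b d by auto
    then have "\<bar>max 0 a - (2 - b)\<bar> \<le> d" using right unfolding Pa by simp
    then show ?thesis using 3 a b d unfolding max_def by (simp add: abs_le_iff split: if_splits)
  qed
qed

lemma hat_inverse_lipschitz:
  assumes s: "0 \<le> s" and t: "0 \<le> t" and d: "d < 1/2"
    and le: "\<And>m. \<bar>hat m s - hat m t\<bar> \<le> d"
  shows "\<bar>s - t\<bar> \<le> 3 * d"
proof -
  obtain k where k: "2 * real k \<le> s" "s < 2 * real k + 2"
    using even_floor_obtain[OF s] by blast
  \<comment> \<open>A nearest even number: its hat is 1 at \<open>s\<close>, hence at least
    \<open>1 - d\<close> at \<open>t\<close>, which keeps \<open>t\<close> within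
    \<open>1 + d\<close> of it.\<close>
  obtain e where e: "even e" "\<bar>s - real e\<bar> \<le> 1"
  proof (cases "s \<le> 2 * real k + 1")
    case True
    then show ?thesis using k by (intro that[of "2 * k"]) auto
  next
    case False
    then show ?thesis using k by (intro that[of "2 * k + 2"]) auto
  qed
  have d0: "0 \<le> d" using le[of 0] by linarith
  have "hat e s = 1" using e by (auto simp: hat_def)
  then have "1 - d \<le> hat e t" using le[of e] by linarith
  then have te: "\<bar>t - real e\<bar> \<le> 1 + d" using e d by (auto simp: hat_def split: if_splits)
  have right: "\<bar>max 0 (1 - \<bar>(s - real e) - 1\<bar>) - max 0 (1 - \<bar>(t - real e) - 1\<bar>)\<bar> \<le> d"
    using le[of "Suc e"] e by (simp add: hat_def algebra_simps)
  \<comment> \<open>For \<open>e = 0\<close> there is no odd neighbour on the left, but a tent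
    centred at -1 vanishes at nonnegative points.\<close>
  have left: "\<bar>max 0 (1 - \<bar>(s - real e) + 1\<bar>) - max 0 (1 - \<bar>(t - real e) + 1\<bar>)\<bar> \<le> d"
  proof (cases e)
    case 0
    then show ?thesis using s t d0 by simp
  next
    case (Suc j)
    then show ?thesis using le[of j] e by (simp add: hat_def algebra_simps)
  qed
  show ?thesis
    using tent_pair_inverse[OF e(2) te d right left] by simp
qed

lemma hat_of_nat_pos_iff: "0 < hat m (real p) \<longleftrightarrow> fence_le m p"
proof
  show "fence_le m p \<Longrightarrow> 0 < hat m (real p)"
    using hat_antimono[of m p "real p"] by simp
  assume "0 < hat m (real p)"
  then have "if even m then \<bar>int p - int m\<bar> < 2 else \<bar>int p - int m\<bar> < 1"
    by (auto simp: hat_def split: if_splits)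
  then show "fence_le m p"
    by (auto simp: fence_le_def split: if_splits)
qed

text \<open>A chain in the fence takes at most two values, an even \<open>e\<close> and an adjacent
  odd \<open>x\<close>. Each \<open>hat m\<close> is affine on the segment between them and is the
  indicator of \<open>fence_le m\<close> at integers, so it commutes with the convex
  combination.\<close>

lemma hat_convex_combination:
  assumes fin: "finite C" and w: "\<And>p. p \<in> C \<Longrightarrow> 0 \<le> w p" "sum w C = 1"
    and chain: "\<And>p q. p \<in> C \<Longrightarrow> q \<in> C \<Longrightarrow> fence_le (b p) (b q) \<or> fence_le (b q) (b p)"
  shows "hat m (\<Sum>p\<in>C. w p * real (b p)) = (\<Sum>p\<in>{p\<in>C. fence_le m (b p)}. w p)"
proof -
  have "C \<noteq> {}" using w by auto
  then obtain p0 where p0: "p0 \<in> C" by blast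
  have "\<exists>e x. even e \<and> odd x \<and> (x = Suc e \<or> e = Suc x) \<and> (\<forall>p\<in>C. b p = e \<or> b p = x)"
  proof (cases "\<exists>p\<in>C. odd (b p)")
    case True
    then obtain p1 where p1: "p1 \<in> C" "odd (b p1)" by blast
    show ?thesis
    proof (cases "\<exists>p\<in>C. even (b p)")
      case True
      then obtain p2 where p2: "p2 \<in> C" "even (b p2)" by blast
      have "b p = b p2 \<or> b p = b p1" if "p \<in> C" for p
        using chain[OF that p1(1)] chain[OF that p2(1)] p1(2) p2(2) by (auto simp: fence_le_def)
      then show ?thesis using chain[OF p1(1) p2(1)] p1(2) p2(2)
        by (intro exI[of _ "b p2"] exI[of _ "b p1"]) (auto simp: fence_le_def)
    next
      case False
      then have "b p = b p1" if "p \<in> C" for p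
        using chain[OF that p1(1)] that p1(2) by (auto simp: fence_le_def)
      then show ?thesis using p1(2)
        by (intro exI[of _ "Suc (b p1)"] exI[of _ "b p1"]) auto
    qed
  next
    case False
    then have "b p = b p0" if "p \<in> C" for p
      using chain[OF that p0] that p0 False unfolding fence_le_def by (metis even_Suc)
    then show ?thesis using False p0
      by (intro exI[of _ "b p0"] exI[of _ "Suc (b p0)"]) (metis even_Suc)
  qed
  then obtain e x where e: "even e" and x: "odd x" "x = Suc e \<or> e = Suc x"
    and b: "\<forall>p\<in>C. b p = e \<or> b p = x" by (elim exE conjE) (rule that)
  have ne: "e \<noteq> x" using e x(1) by blast
  define a where "a = (\<Sum>p\<in>{p\<in>C. b p = x}. w p)"
  have split: "sum g C = sum g {p\<in>C. b p = e} + sum g {p\<in>C. b p = x}" for g :: "_ \<Rightarrow> real"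
  proof -
    have "sum g ({p\<in>C. b p = e} \<union> {p\<in>C. b p = x}) = sum g {p\<in>C. b p = e} + sum g {p\<in>C. b p = x}"
      using ne fin by (intro sum.union_disjoint) auto
    moreover have "{p\<in>C. b p = e} \<union> {p\<in>C. b p = x} = C" using b by blast
    ultimately show ?thesis by simp
  qed
  have ea: "(\<Sum>p\<in>{p\<in>C. b p = e}. w p) = 1 - a"
    using split[of w] w by (simp add: a_def)
  have a: "0 \<le> a" "a \<le> 1"
  proof -
    show "0 \<le> a" unfolding a_def by (intro sum_nonneg) (use w in auto)
    have "0 \<le> (\<Sum>p\<in>{p\<in>C. b p = e}. w p)" by (intro sum_nonneg) (use w in auto)
    then show "a \<le> 1" using ea by simp
  qed
  have "(\<Sum>p\<in>{p\<in>C. b p = y}. w p * real (b p)) = (\<Sum>p\<in>{p\<in>C. b p = y}. w p) * real y" for y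
    by (simp add: sum_distrib_right)
  then have "(\<Sum>p\<in>C. w p * real (b p)) = (1 - a) * real e + a * real x"
    using split[of "\<lambda>p. w p * real (b p)"] ea a_def by simp
  then have t: "(\<Sum>p\<in>C. w p * real (b p)) = real e + a * (real x - real e)"
    by (simp add: algebra_simps)
  have rhs: "(\<Sum>p\<in>{p\<in>C. fence_le m (b p)}. w p)
      = (if fence_le m e then 1 else if fence_le m x then a else 0)"
  proof (cases "fence_le m e")
    case True
    then have "{p\<in>C. fence_le m (b p)} = C"
      using b x e by (auto simp: fence_le_def)
    then show ?thesis using True w by simp
  next
    case False
    show ?thesis
    proof (cases "fence_le m x")
      case True
      then have "{p\<in>C. fence_le m (b p)} = {p\<in>C. b p = x}"
        using b False by auto
      then show ?thesis using True False by (simp add: a_def)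
    next
      case False': False
      then have "{p\<in>C. fence_le m (b p)} = {}"
        using b False by auto
      then show ?thesis using False False' by (simp only: sum.empty if_False)
    qed
  qed
  have me: "fence_le m e \<longleftrightarrow> m = e" using e by (auto simp: fence_le_def)
  have mx: "fence_le m x \<longleftrightarrow> m = x \<or> m = Suc x \<or> Suc m = x" using x by (auto simp: fence_le_def)
  show ?thesis unfolding rhs t me mx
  proof (cases "m = e \<or> m = x \<or> m = Suc x \<or> Suc m = x")
    case True
    from x(2) show "hat m (real e + a * (real x - real e)) = (if m = e then 1 else if m = x \<or> m = Suc x \<or> Suc m = x then a else 0)"
    proof
      assume xe: "x = Suc e"
      from True have "m = e \<or> m = Suc e \<or> m = Suc (Suc e)" unfolding xe by auto
      then show ?thesis unfolding xe using e a by (elim disjE) (simp_all add: hat_def)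
    next
      assume ex: "e = Suc x"
      from True have "m = Suc x \<or> m = x \<or> Suc m = x" unfolding ex by blast
      then show ?thesis
      proof (elim disjE)
        assume mx: "Suc m = x"
        have "even m" using x(1) unfolding mx[symmetric] by simp
        then show ?thesis unfolding ex mx[symmetric] using a by (simp add: hat_def)
      qed (use x(1) a in \<open>simp_all add: hat_def ex\<close>)
    qed
  next
    case False
    have t1: "\<bar>real e + a * (real x - real e) - real x\<bar> \<le> 1"
      using x(2)
    proof
      assume "x = Suc e"
      then show ?thesis using a by (simp add: abs_le_iff)
    next
      assume "e = Suc x"
      then show ?thesis using a by (simp add: abs_le_iff)
    qed
    have m2: "\<bar>int m - int x\<bar> \<ge> 2" using False by linarith
    \<comment> \<open>Even hats have radius 2 and the combination may lie 1 away from
      \<open>x\<close>, so distance 3 is needed. As \<open>m\<close> and \<open>x\<close> differ in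
      parity, distance 2 is impossible.\<close>
    have m3: "\<bar>int m - int x\<bar> \<ge> 3" if "even m"
    proof -
      have odd: "odd (int m - int x)" using that x(1) by simp
      have "\<bar>int m - int x\<bar> \<noteq> 2"
      proof
        assume "\<bar>int m - int x\<bar> = 2"
        then have "even \<bar>int m - int x\<bar>" by (simp only: even_numeral)
        then show False using odd by simp
      qed
      then show ?thesis using m2 by linarith
    qed
    define z where "z = real e + a * (real x - real e)"
    have "hat m z = 0"
    proof (cases "even m")
      case True
      have "\<bar>real m - real x\<bar> \<ge> 3" using m3[OF True] by linarith
      then have "2 - \<bar>z - real m\<bar> \<le> 0" using t1 unfolding z_def[symmetric] by linarith
      then show ?thesis using True by (simp add: hat_def)
    next
      case False
      have "\<bar>real m - real x\<bar> \<ge> 2" using m2 by linarith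
      then have "1 - \<bar>z - real m\<bar> \<le> 0" using t1 unfolding z_def[symmetric] by linarith
      then show ?thesis using False by (simp add: hat_def)
    qed
    then show "hat m (real e + a * (real x - real e)) = (if m = e then 1 else if m = x \<or> m = Suc x \<or> Suc m = x then a else 0)"
      using False unfolding z_def by simp
  qed
qed

section \<open>Membership in a geometric realization\<close>

text \<open>The inner maximum is the predecessor of \<open>v\<close> in \<open>insert 0 A\<close>,
  so the sum of gaps telescopes.\<close>

lemma layer_cake_Max:
  fixes A :: "real set"
  assumes "finite A" "\<And>v. v \<in> A \<Longrightarrow> 0 < v"
  shows "(\<Sum>v\<in>A. v - Max (insert 0 {u\<in>A. u < v})) = Max (insert 0 A)"
  using assms
proof (induction rule: finite_linorder_max_induct)
  case empty
  show ?case by simp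
next
  case (insert b A)
  have lower: "{u \<in> insert b A. u < v} = {u \<in> A. u < v}" if "v \<in> A" for v
    using insert that by force
  have below: "{u \<in> insert b A. u < b} = A"
    using insert by auto
  have "b \<notin> A" using insert by auto
  then have "(\<Sum>v\<in>insert b A. v - Max (insert 0 {u\<in>insert b A. u < v}))
      = (b - Max (insert 0 A)) + (\<Sum>v\<in>A. v - Max (insert 0 {u\<in>A. u < v}))"
    using insert(1) below lower by (simp add: sum.insert)
  also have "\<dots> = b" using insert by simp
  also have "b = Max (insert 0 (insert b A))"
    using insert by (intro Max_eqI[symmetric]) (auto simp: less_imp_le)
  finally show ?case .
qed

lemma layer_cake:
  fixes A :: "real set"
  assumes "finite A" "\<And>v. v \<in> A \<Longrightarrow> 0 < v" and z: "z \<in> insert 0 A"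
  shows "(\<Sum>v\<in>{v\<in>A. v \<le> z}. v - Max (insert 0 {u\<in>A. u < v})) = z"
proof -
  have "{u \<in> {v\<in>A. v \<le> z}. u < v} = {u \<in> A. u < v}" if "v \<le> z" for v
    using that by auto
  then have "(\<Sum>v\<in>{v\<in>A. v \<le> z}. v - Max (insert 0 {u\<in>A. u < v}))
     = (\<Sum>v\<in>{v\<in>A. v \<le> z}. v - Max (insert 0 {u\<in>{v\<in>A. v \<le> z}. u < v}))"
    by (intro sum.cong) auto
  also have "\<dots> = Max (insert 0 {v\<in>A. v \<le> z})"
    using assms by (intro layer_cake_Max) auto
  also have "\<dots> = z"
    using assms by (intro Max_eqI) (auto simp: less_imp_le)
  finally show ?thesis .
qed

lemma apply_bcontfun_sum:
  "apply_bcontfun (\<Sum>i\<in>A. g i) s = (\<Sum>i\<in>A. apply_bcontfun (g i) s)"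
  by (induction A rule: infinite_finite_induct) auto

lemma finite_chain_greatest:
  assumes "finite C" "C \<noteq> {}" "C \<in> Chains r" "trans r"
  shows "\<exists>m\<in>C. \<forall>k\<in>C. (k, m) \<in> r"
  using assms
proof (induction rule: finite_ne_induct)
  case (singleton x)
  then show ?case by (auto simp: Chains_def)
next
  case (insert x F)
  then obtain m where m: "m \<in> F" "\<forall>k\<in>F. (k, m) \<in> r"
    by (auto simp: Chains_def)
  from insert have "(x, x) \<in> r" "(x, m) \<in> r \<or> (m, x) \<in> r"
    using m by (auto simp: Chains_def)
  then show ?case
    using m \<open>trans r\<close> by (metis insert_iff transD)
qed

text \<open>Such a function is the sum, over its positive values \<open>v\<close>, of the gap below
  \<open>v\<close> times the indicator of \<open>{q. v \<le> f q}\<close>. Each indicator is a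
  vertex by \<open>principal\<close>; higher levels give smaller down-sets, so the vertices form a
  chain; the gaps add up to the largest value, which is 1.\<close>

lemma geometric_realization_memI:
  fixes f :: "'p::discrete_topology \<Rightarrow> real"
  assumes r: "partial_order_on P r"
    and fin: "finite (range f)" and range: "range f \<subseteq> {0..1}" and one: "1 \<in> range f"
    and principal: "\<And>v. v \<in> range f \<Longrightarrow> 0 < v \<Longrightarrow> \<exists>p\<in>P. \<forall>q. v \<le> f q \<longleftrightarrow> (q, p) \<in> r"
  shows "apply_bcontfun (Bcontfun f) = f" and "Bcontfun f \<in> geometric_realization P r"
proof -
  have "bounded (range f)" using range by (rule bounded_subset[rotated]) auto
  then have "f \<in> bcontfun" by (simp add: bcontfun_def)
  then show app: "apply_bcontfun (Bcontfun f) = f" by (rule Bcontfun_inverse)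
  have refl: "(p, p) \<in> r" if "p \<in> P" for p
    using r that by (auto simp: partial_order_on_def preorder_on_def refl_on_def)
  have rP: "r \<subseteq> P \<times> P" using r by (auto simp: partial_order_on_def preorder_on_def)
  define V where "V = range f - {0}"
  have V: "finite V" "\<And>v. v \<in> V \<Longrightarrow> 0 < v" "\<And>v. v \<in> V \<Longrightarrow> v \<le> 1" "1 \<in> V"
    using fin range one by (auto simp: V_def less_le)
  have "\<forall>v\<in>V. \<exists>p. p \<in> P \<and> (\<forall>q. v \<le> f q \<longleftrightarrow> (q, p) \<in> r)"
    using principal V(2) unfolding V_def by blast
  then obtain p where p: "\<And>v. v \<in> V \<Longrightarrow> p v \<in> P"
    "\<And>v q. v \<in> V \<Longrightarrow> v \<le> f q \<longleftrightarrow> (q, p v) \<in> r"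
    by metis
  define w where "w v = v - Max (insert 0 {u\<in>V. u < v})" for v
  have chain: "(p u, p v) \<in> r" if "u \<in> V" "v \<in> V" "v \<le> u" for u v
  proof -
    have "u \<le> f (p u)" using p that refl by blast
    then show ?thesis using p(2)[OF that(2), of "p u"] that(3) by linarith
  qed
  let ?C = "p ` V"
  have C: "?C \<subseteq> P" "finite ?C" "?C \<noteq> {}" "?C \<in> Chains r"
    using p V chain by (auto simp: Chains_def) (meson linear)
  have w0: "0 \<le> w v" if "v \<in> V" for v
    using that V unfolding w_def by (auto simp: less_imp_le)
  have w1: "sum w V = 1"
  proof -
    have "{v \<in> V. v \<le> 1} = V" using V by auto
    then show ?thesis using layer_cake[OF V(1,2), of 1] V unfolding w_def by simp
  qed
  have "Bcontfun f = (\<Sum>v\<in>V. w v *\<^sub>R poset_vertex P r (p v))"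
  proof (rule bcontfun_eqI)
    fix q
    have "apply_bcontfun (\<Sum>v\<in>V. w v *\<^sub>R poset_vertex P r (p v)) q
        = (\<Sum>v\<in>V. if v \<le> f q then w v else 0)"
      unfolding apply_bcontfun_sum using p rP
      by (intro sum.cong) (auto simp: apply_poset_vertex indicator_def)
    also have "\<dots> = (\<Sum>v\<in>{v\<in>V. v \<le> f q}. w v)"
      using V by (simp add: sum.inter_filter)
    also have "\<dots> = f q" unfolding w_def
      by (rule layer_cake[OF V(1,2)]) (auto simp: V_def)
    finally show "apply_bcontfun (Bcontfun f) q = apply_bcontfun (\<Sum>v\<in>V. w v *\<^sub>R poset_vertex P r (p v)) q"
      by (simp add: app)
  qed
  also have "\<dots> \<in> convex hull (poset_vertex P r ` ?C)"
    using V(1) w0 w1 by (intro convex_sum) (auto intro: hull_inc)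
  finally show "Bcontfun f \<in> geometric_realization P r"
    unfolding geometric_realization_def using C by blast
qed

lemma geometric_realization_memE:
  fixes f :: "'p::discrete_topology \<Rightarrow>\<^sub>C real"
  assumes r: "partial_order_on P r" and f: "f \<in> geometric_realization P r"
  obtains C w where "finite C" "C \<noteq> {}" "C \<subseteq> P" "C \<in> Chains r"
    "\<And>p. p \<in> C \<Longrightarrow> 0 \<le> w p" "sum w C = 1"
    "\<And>s. apply_bcontfun f s = (\<Sum>p\<in>{p\<in>C. (s, p) \<in> r}. w p)"
proof -
  obtain C where C: "C \<subseteq> P" "finite C" "C \<noteq> {}" "C \<in> Chains r"
    and hull: "f \<in> convex hull (poset_vertex P r ` C)"
    using f unfolding geometric_realization_def by blast
  have rP: "r \<subseteq> P \<times> P" and refl: "\<And>p. p \<in> P \<Longrightarrow> (p, p) \<in> r" and "antisym r"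
    using r by (auto simp: partial_order_on_def preorder_on_def refl_on_def)
  \<comment> \<open>The hull attaches weights to functions; injectivity transfers them to elements
    of the poset.\<close>
  have inj: "inj_on (poset_vertex P r) C"
  proof (rule inj_onI)
    fix p q assume pq: "p \<in> C" "q \<in> C" "poset_vertex P r p = poset_vertex P r q"
    have "indicator {s \<in> P. (s, p) \<in> r} s = (indicator {s \<in> P. (s, q) \<in> r} s :: real)" for s
      using arg_cong[OF pq(3), of "\<lambda>g. apply_bcontfun g s"] by (simp add: apply_poset_vertex)
    from this[of p] this[of q] have "(p, q) \<in> r" "(q, p) \<in> r"
      using pq C(1) refl by (auto simp: indicator_def split: if_splits)
    then show "p = q" using \<open>antisym r\<close> by (auto dest: antisymD)
  qed
  obtain u where u: "\<forall>x\<in>poset_vertex P r ` C. 0 \<le> u x" "sum u (poset_vertex P r ` C) = 1"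
    "(\<Sum>x\<in>poset_vertex P r ` C. u x *\<^sub>R x) = f"
    using hull C by (auto simp: convex_hull_finite)
  define w where "w p = u (poset_vertex P r p)" for p
  have "f = (\<Sum>p\<in>C. w p *\<^sub>R poset_vertex P r p)"
    using u(3) by (simp add: sum.reindex[OF inj] w_def)
  then have "apply_bcontfun f s = (\<Sum>p\<in>C. if (s, p) \<in> r then w p else 0)" for s
    using rP by (auto simp: apply_bcontfun_sum apply_poset_vertex indicator_def intro!: sum.cong)
  then have "apply_bcontfun f s = (\<Sum>p\<in>{p\<in>C. (s, p) \<in> r}. w p)" for s
    using C by (simp add: sum.inter_filter)
  moreover have "sum w C = 1"
    using u(2) by (simp add: sum.reindex[OF inj] w_def)
  moreover have "\<And>p. p \<in> C \<Longrightarrow> 0 \<le> w p" using u(1) by (simp add: w_def)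
  ultimately show ?thesis using that C by blast
qed

section \<open>Cubical complexes as uniform polyhedra\<close>

text \<open>
  A down-set \<open>P\<close> of finitely supported vectors in the power of the fence. Its realization is isomorphic
  to the set \<open>points\<close> of those points of the positive cone whose carrier cube lies in \<open>P\<close>;
  \<open>enc\<close> replaces the vectors by numbers, since the realizations live over the index type \<open>nat\<close>.
\<close>

locale fence_complex =
  fixes P :: "('c \<Rightarrow> nat) set"
  assumes countable: "countable P"
    and finite_support: "\<And>p. p \<in> P \<Longrightarrow> finite {c. p c \<noteq> 0}"
    and down_closed: "\<And>p q. q \<in> P \<Longrightarrow> (\<And>c. fence_le (p c) (q c)) \<Longrightarrow> p \<in> P"
begin

definition enc :: "('c \<Rightarrow> nat) \<Rightarrow> nat" where
  "enc = to_nat_on P"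

definition vert :: "nat set" where
  "vert = enc ` P"

definition vert_le :: "(nat \<times> nat) set" where
  "vert_le = {(enc p, enc q) | p q. p \<in> P \<and> q \<in> P \<and> (\<forall>c. fence_le (p c) (q c))}"

text \<open>The \<open>m\<close> with \<open>0 < hat m t\<close> are the faces of the cell with
  \<open>t\<close> in its relative interior. So the condition on \<open>q\<close> ranges over the
  faces of the carrier cube without having to name that cube.\<close>

definition points :: "('c \<Rightarrow> real) set" where
  "points = {x. (\<forall>c. 0 \<le> x c) \<and> finite {c. x c \<noteq> 0} \<and> (\<forall>q. (\<forall>c. 0 < hat (q c) (x c)) \<longrightarrow> q \<in> P)}"

text \<open>A superlevel set of a point of a product is the product of the superlevel sets of its
  coordinates, so the value at \<open>q\<close> has to be an infimum.\<close>

definition coord :: "('c \<Rightarrow> real) \<Rightarrow> ('c \<Rightarrow> nat) \<Rightarrow> real" where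
  "coord x q = (INF c. hat (q c) (x c))"

definition embed_fun :: "('c \<Rightarrow> real) \<Rightarrow> nat \<Rightarrow> real" where
  "embed_fun x k = (if k \<in> vert then coord x (from_nat_into P k) else 0)"

definition embed :: "('c \<Rightarrow> real) \<Rightarrow> nat \<Rightarrow>\<^sub>C real" where
  "embed x = Bcontfun (embed_fun x)"

lemma enc_inverse [simp]: "p \<in> P \<Longrightarrow> from_nat_into P (enc p) = p"
  by (simp add: enc_def countable)

lemma enc_inject [simp]: "p \<in> P \<Longrightarrow> q \<in> P \<Longrightarrow> enc p = enc q \<longleftrightarrow> p = q"
  by (metis enc_inverse)

lemma enc_vert [simp]: "p \<in> P \<Longrightarrow> enc p \<in> vert"
  by (simp add: vert_def)

lemma vert_le_iff [simp]:
  "p \<in> P \<Longrightarrow> q \<in> P \<Longrightarrow> (enc p, enc q) \<in> vert_le \<longleftrightarrow> (\<forall>c. fence_le (p c) (q c))"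
  by (auto simp: vert_le_def)

lemma partial_order_vert: "partial_order_on vert vert_le"
  unfolding partial_order_on_def preorder_on_def
proof (intro conjI)
  show "vert_le \<subseteq> vert \<times> vert" by (auto simp: vert_le_def)
  show "refl_on vert vert_le" by (auto simp: refl_on_def vert_def)
  show "trans vert_le"
  proof (rule transI)
    fix x y z assume "(x, y) \<in> vert_le" "(y, z) \<in> vert_le"
    then obtain p q q' s where *: "x = enc p" "y = enc q" "y = enc q'" "z = enc s"
      "p \<in> P" "q \<in> P" "q' \<in> P" "s \<in> P" "\<forall>c. fence_le (p c) (q c)" "\<forall>c. fence_le (q' c) (s c)"
      unfolding vert_le_def by blast
    then have "q = q'" by (metis enc_inject)
    with * have "\<forall>c. fence_le (p c) (s c)" using fence_le_trans by blast
    then show "(x, z) \<in> vert_le" using * by simp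
  qed
  show "antisym vert_le"
  proof (rule antisymI)
    fix x y assume xy: "(x, y) \<in> vert_le" "(y, x) \<in> vert_le"
    then obtain p q where *: "x = enc p" "y = enc q" "p \<in> P" "q \<in> P"
      unfolding vert_le_def by blast
    have "fence_le (p c) (q c)" "fence_le (q c) (p c)" for c
      using xy * by simp_all
    then have "p = q" by (intro ext fence_le_antisym)
    then show "x = y" using * by simp
  qed
qed

text \<open>Joins are taken coordinatewise. Where the family is constant its value is kept;
  elsewhere \<open>fence_bound_unique\<close> leaves the coordinate of \<open>u\<close> as the only
  upper bound. The join is below \<open>u\<close> and so stays in the down-set
  \<open>P\<close>.\<close>

lemma conditionally_complete_vert: "conditionally_complete vert vert_le"
  unfolding conditionally_complete_def
proof (intro allI impI, elim conjE bexE)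
  fix A k assume A: "A \<subseteq> vert" "A \<noteq> {}" and k: "k \<in> vert" "\<forall>a\<in>A. (a, k) \<in> vert_le"
  define B where "B = {p \<in> P. enc p \<in> A}"
  have AB: "A = enc ` B" and BP: "B \<subseteq> P" and "B \<noteq> {}" using A by (auto simp: B_def vert_def)
  then obtain b where b: "b \<in> B" by blast
  obtain u where u: "u \<in> P" "k = enc u" using k by (auto simp: vert_def)
  have Bu: "fence_le (p c) (u c)" if "p \<in> B" for p c
  proof -
    have "p \<in> P" "(enc p, enc u) \<in> vert_le" using k(2) u that by (auto simp: B_def)
    then show ?thesis using u by simp
  qed
  define s where "s c = (if \<forall>p\<in>B. p c = b c then b c else u c)" for c
  have "fence_le (s c) (u c)" for c using Bu[OF b] by (simp add: s_def)
  then have sP: "s \<in> P" using down_closed u by blast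
  have Bs: "fence_le (p c) (s c)" if "p \<in> B" for p c
    using that Bu by (simp add: s_def)
  have least: "fence_le (s c) (v c)" if v: "\<And>p. p \<in> B \<Longrightarrow> fence_le (p c) (v c)" for v c
  proof (cases "\<forall>p\<in>B. p c = b c")
    case True
    then show ?thesis using v[OF b] by (simp add: s_def)
  next
    case False
    then obtain p where "p \<in> B" "p c \<noteq> b c" by blast
    then have "u c = v c"
      using fence_bound_unique[of "p c" "u c" "b c" "v c"] Bu v b by blast
    moreover have "s c = u c" using False unfolding s_def by (rule if_not_P)
    ultimately show ?thesis by simp
  qed
  show "\<exists>s\<in>vert. (\<forall>a\<in>A. (a, s) \<in> vert_le) \<and> (\<forall>u\<in>vert. (\<forall>a\<in>A. (a, u) \<in> vert_le) \<longrightarrow> (s, u) \<in> vert_le)"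
  proof (intro bexI[of _ "enc s"] conjI ballI impI)
    show "enc s \<in> vert" using sP by simp
    show "(a, enc s) \<in> vert_le" if "a \<in> A" for a
    proof -
      obtain p where "p \<in> B" "a = enc p" using \<open>a \<in> A\<close> AB by blast
      then show ?thesis using BP sP Bs by (simp add: subset_iff)
    qed
    show "(enc s, l) \<in> vert_le" if "l \<in> vert" "\<forall>a\<in>A. (a, l) \<in> vert_le" for l
    proof -
      obtain v where v: "v \<in> P" "l = enc v" using \<open>l \<in> vert\<close> by (auto simp: vert_def)
      have "fence_le (p c) (v c)" if "p \<in> B" for p c
      proof -
        have "p \<in> P" "(enc p, enc v) \<in> vert_le"
          using \<open>\<forall>a\<in>A. (a, l) \<in> vert_le\<close> v that by (auto simp: B_def)
        then show ?thesis using v by simp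
      qed
      then show ?thesis using least v sP by simp
    qed
  qed
qed

section \<open>The set of points as the realization of the face poset\<close>

lemma bdd_below_hats: "bdd_below (range (\<lambda>c. hat (q c) (x c)))"
  by (rule bdd_belowI2[of _ 0]) (rule hat_nonneg)

lemma coord_ge_iff: "u \<le> coord x q \<longleftrightarrow> (\<forall>c. u \<le> hat (q c) (x c))"
  unfolding coord_def using bdd_below_hats by (subst le_cINF_iff) auto

lemma coord_le: "coord x q \<le> hat (q c) (x c)"
  using coord_ge_iff by blast

lemma coord_nonneg: "0 \<le> coord x q"
  by (simp add: coord_ge_iff hat_nonneg)

lemma coord_le_1: "coord x q \<le> 1"
  using coord_le hat_le_1 order_trans by blast

text \<open>Coordinates outside the support are all 0, so only finitely many hat values occur and
  every infimum is a minimum.\<close>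

lemma finite_coord_values:
  assumes "\<And>c. 0 \<le> x c" "finite {c. x c \<noteq> 0}"
  shows "finite (range (coord x))"
proof -
  have "range x \<subseteq> insert 0 (x ` {c. x c \<noteq> 0})" by auto
  then have "finite (range x)" using assms(2) by (meson finite_imageI finite_insert finite_subset)
  then have fin: "finite (\<Union>t\<in>range x. range (\<lambda>m. hat m t))"
    using finite_hat_values assms(1) by (intro finite_UN_I) auto
  have "coord x q \<in> (\<Union>t\<in>range x. range (\<lambda>m. hat m t))" for q
  proof -
    let ?V = "range (\<lambda>c. hat (q c) (x c))"
    have sub: "?V \<subseteq> (\<Union>t\<in>range x. range (\<lambda>m. hat m t))" by auto
    then have "finite ?V" using fin finite_subset by blast
    then have "Inf ?V \<in> ?V" using Min_in[of ?V] by (simp add: cInf_eq_Min)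
    then show ?thesis using sub unfolding coord_def by blast
  qed
  then have "range (coord x) \<subseteq> (\<Union>t\<in>range x. range (\<lambda>m. hat m t))" by blast
  then show ?thesis using fin finite_subset by blast
qed

lemma embed_fun_enc [simp]: "q \<in> P \<Longrightarrow> embed_fun x (enc q) = coord x q"
  by (simp add: embed_fun_def)

lemma
  assumes x: "x \<in> points"
  shows apply_embed: "apply_bcontfun (embed x) = embed_fun x"
    and embed_mem: "embed x \<in> geometric_realization vert vert_le"
proof -
  have x0: "\<And>c. 0 \<le> x c" and xf: "finite {c. x c \<noteq> 0}"
    and xP: "\<And>q. (\<And>c. 0 < hat (q c) (x c)) \<Longrightarrow> q \<in> P"
    using x by (auto simp: points_def)
  have fin: "finite (range (embed_fun x))"
  proof -
    have "range (embed_fun x) \<subseteq> insert 0 (range (coord x))" by (auto simp: embed_fun_def)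
    then show ?thesis using finite_coord_values[OF x0 xf] by (meson finite_insert finite_subset)
  qed
  have range: "range (embed_fun x) \<subseteq> {0..1}"
    using coord_nonneg coord_le_1 by (auto simp: embed_fun_def)
  have one: "1 \<in> range (embed_fun x)"
  proof -
    have "\<forall>c. \<exists>m. hat m (x c) = 1" using hat_eq_1_exists x0 by blast
    then obtain q where q: "\<And>c. hat (q c) (x c) = 1" by metis
    then have "q \<in> P" by (intro xP) simp
    moreover have "coord x q = 1" using q by (simp add: coord_def)
    ultimately show ?thesis using embed_fun_enc by (metis rangeI)
  qed
  \<comment> \<open>The generator of a superlevel set is assembled from the generators in the
    coordinates. All its hats are positive at \<open>x\<close>, which by definition of
    \<open>points\<close> puts it into \<open>P\<close>.\<close>
  have principal: "\<exists>p\<in>vert. \<forall>k. v \<le> embed_fun x k \<longleftrightarrow> (k, p) \<in> vert_le"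
    if "v \<in> range (embed_fun x)" "0 < v" for v
  proof -
    have "v \<le> 1" using that range by auto
    then have "\<forall>c. \<exists>p. \<forall>m. v \<le> hat m (x c) \<longleftrightarrow> fence_le m p"
      using hat_superlevel_principal x0 \<open>0 < v\<close> by blast
    then obtain p where p: "\<And>c m. v \<le> hat m (x c) \<longleftrightarrow> fence_le m (p c)" by metis
    have "v \<le> hat (p c) (x c)" for c using p by simp
    then have pP: "p \<in> P" using \<open>0 < v\<close> by (intro xP) (rule less_le_trans)
    have "v \<le> embed_fun x k \<longleftrightarrow> (k, enc p) \<in> vert_le" for k
    proof (cases "k \<in> vert")
      case True
      then obtain q where "q \<in> P" "k = enc q" by (auto simp: vert_def)
      then show ?thesis using pP by (simp add: coord_ge_iff p)
    next
      case False
      then have "(k, enc p) \<notin> vert_le" by (auto simp: vert_le_def)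
      then show ?thesis using False \<open>0 < v\<close> by (simp add: embed_fun_def)
    qed
    then show ?thesis using enc_vert[OF pP] by (intro bexI[of _ "enc p"] allI)
  qed
  show "apply_bcontfun (embed x) = embed_fun x"
    unfolding embed_def
    by (rule geometric_realization_memI(1)[OF partial_order_vert fin range one principal])
  show "embed x \<in> geometric_realization vert vert_le"
    unfolding embed_def
    by (rule geometric_realization_memI(2)[OF partial_order_vert fin range one principal])
qed

lemma dist_embed_le:
  assumes x: "x \<in> points" and y: "y \<in> points" and le: "\<And>c. \<bar>x c - y c\<bar> \<le> d"
  shows "dist (embed x) (embed y) \<le> d"
proof (rule dist_bound)
  have half: "coord x q - d \<le> coord y q" if "\<And>c. \<bar>x c - y c\<bar> \<le> d" for x y q
    unfolding coord_ge_iff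
  proof
    fix c show "coord x q - d \<le> hat (q c) (y c)"
      using coord_le[of x q c] hat_lipschitz[of "q c" "x c" "y c"] that[of c] by linarith
  qed
  have d0: "0 \<le> d" using le[of undefined] by linarith
  fix k
  have "\<bar>coord x q - coord y q\<bar> \<le> d" for q
    using half[of x y q] half[of y x q] le by (auto simp: abs_le_iff abs_minus_commute)
  then show "dist (apply_bcontfun (embed x) k) (apply_bcontfun (embed y) k) \<le> d"
    using d0 x y by (simp add: apply_embed embed_fun_def dist_real_def)
qed

text \<open>One coordinate is isolated by a vector \<open>q\<close> whose other hats equal 1 at
  \<open>x\<close>: its infimum at \<open>x\<close> is then \<open>hat m (x c)\<close>, and at
  \<open>y\<close> it is at most \<open>hat m (y c)\<close>.\<close>

lemma hat_diff_le_dist_embed: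
  assumes x: "x \<in> points" and y: "y \<in> points"
  shows "hat m (x c) - hat m (y c) \<le> dist (embed x) (embed y)"
proof (cases "0 < hat m (x c)")
  case True
  have "\<forall>c. \<exists>m. hat m (x c) = 1" using hat_eq_1_exists x unfolding points_def by blast
  then obtain q0 where q0: "\<And>c. hat (q0 c) (x c) = 1" by metis
  define q where "q = q0(c := m)"
  have "0 < hat (q c') (x c')" for c' using True q0 by (simp add: q_def)
  then have qP: "q \<in> P" using x by (simp add: points_def)
  have "hat m (x c) \<le> coord x q"
    unfolding coord_ge_iff using q0 by (simp add: q_def hat_le_1)
  moreover have "coord y q \<le> hat m (y c)" using coord_le[of y q c] by (simp add: q_def)
  moreover have "\<bar>coord x q - coord y q\<bar> \<le> dist (embed x) (embed y)"
    using dist_bounded[of "embed x" "enc q" "embed y"] x y qP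
    by (simp add: apply_embed dist_real_def)
  ultimately show ?thesis by linarith
next
  case False
  then show ?thesis using hat_nonneg[of m "y c"] by (smt (verit) zero_le_dist)
qed

text \<open>Distances in the realization never exceed 1, so a linear bound can hold only for nearby
  points.\<close>

lemma embed_inverse_lipschitz:
  assumes x: "x \<in> points" and y: "y \<in> points" and d: "dist (embed x) (embed y) < 1/2"
  shows "\<bar>x c - y c\<bar> \<le> 3 * dist (embed x) (embed y)"
proof (rule hat_inverse_lipschitz[OF _ _ d])
  show "0 \<le> x c" "0 \<le> y c" using x y by (auto simp: points_def)
  show "\<bar>hat m (x c) - hat m (y c)\<bar> \<le> dist (embed x) (embed y)" for m
    using hat_diff_le_dist_embed[OF x y, of m c] hat_diff_le_dist_embed[OF y x, of m c]
    by (simp add: dist_commute abs_le_iff)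
qed

text \<open>The preimage is the same convex combination, taken of integer vectors instead of vertex
  functions.\<close>

lemma embed_surj:
  assumes f: "f \<in> geometric_realization vert vert_le"
  shows "\<exists>x\<in>points. embed x = f"
proof -
  obtain C w where C: "finite C" "C \<noteq> {}" "C \<subseteq> vert" "C \<in> Chains vert_le"
    and w: "\<And>p. p \<in> C \<Longrightarrow> 0 \<le> w p" "sum w C = 1"
    and fw: "\<And>s. apply_bcontfun f s = (\<Sum>p\<in>{p\<in>C. (s, p) \<in> vert_le}. w p)"
    by (rule geometric_realization_memE[OF partial_order_vert f]) (rule that)
  define d where "d = from_nat_into P"
  have dP: "d k \<in> P" and ed: "enc (d k) = k" if "k \<in> vert" for k
    using that by (auto simp: vert_def d_def)
  have le_iff: "(k, l) \<in> vert_le \<longleftrightarrow> (\<forall>c. fence_le (d k c) (d l c))" if "k \<in> vert" "l \<in> vert" for k l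
    using vert_le_iff[OF dP dP, OF that] ed that by simp
  have chain: "fence_le (d k c) (d l c) \<or> fence_le (d l c) (d k c)" if "k \<in> C" "l \<in> C" for k l c
    using C(3,4) that le_iff unfolding Chains_def by blast
  have trans: "trans vert_le"
    using partial_order_vert by (simp add: partial_order_on_def preorder_on_def)
  define x where "x c = (\<Sum>k\<in>C. w k * real (d k c))" for c
  have hat_x: "hat m (x c) = (\<Sum>k\<in>{k\<in>C. fence_le m (d k c)}. w k)" for m c
    unfolding x_def by (rule hat_convex_combination[OF C(1) w chain])
  have xp: "x \<in> points"
    unfolding points_def
  proof (intro CollectI conjI allI impI)
    show "0 \<le> x c" for c unfolding x_def by (intro sum_nonneg mult_nonneg_nonneg) (use w in auto)
    have "{c. x c \<noteq> 0} \<subseteq> (\<Union>k\<in>C. {c. d k c \<noteq> 0})"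
    proof
      fix c assume "c \<in> {c. x c \<noteq> 0}"
      then have "(\<Sum>k\<in>C. w k * real (d k c)) \<noteq> 0" by (simp add: x_def)
      then obtain k where "k \<in> C" "w k * real (d k c) \<noteq> 0" by (meson sum.not_neutral_contains_not_neutral)
      then show "c \<in> (\<Union>k\<in>C. {c. d k c \<noteq> 0})" by auto
    qed
    moreover have "finite (\<Union>k\<in>C. {c. d k c \<noteq> 0})"
      using C(1,3) dP finite_support by (intro finite_UN_I) auto
    ultimately show "finite {c. x c \<noteq> 0}" by (rule finite_subset)
    \<comment> \<open>The largest cube of the chain contains every \<open>q\<close> whose hats are
      positive at \<open>x\<close>.\<close>
    obtain t where t: "t \<in> C" "\<And>k. k \<in> C \<Longrightarrow> (k, t) \<in> vert_le"
      using finite_chain_greatest[OF C(1,2,4) trans] by blast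
    fix q assume q: "\<forall>c. 0 < hat (q c) (x c)"
    have "fence_le (q c) (d t c)" for c
    proof -
      have "{k\<in>C. fence_le (q c) (d k c)} \<noteq> {}"
        using q hat_x by (metis less_irrefl sum.empty)
      then obtain k where k: "k \<in> C" "fence_le (q c) (d k c)" by blast
      then have "fence_le (d k c) (d t c)" using t C(3) le_iff by blast
      then show ?thesis using k fence_le_trans by blast
    qed
    then show "q \<in> P" using down_closed dP t C(3) by blast
  qed
  have "embed x = f"
  proof (rule bcontfun_eqI)
    fix s
    show "apply_bcontfun (embed x) s = apply_bcontfun f s"
    proof (cases "s \<in> vert")
      case False
      then have "{p\<in>C. (s, p) \<in> vert_le} = {}" by (auto simp: vert_le_def)
      then have "apply_bcontfun f s = 0" unfolding fw by (simp only: sum.empty)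
      then show ?thesis unfolding apply_embed[OF xp] using False by (simp add: embed_fun_def)
    next
      case True
      define q where "q = d s"
      let ?A = "{k\<in>C. (s, k) \<in> vert_le}"
      let ?Ac = "\<lambda>c. {k\<in>C. fence_le (q c) (d k c)}"
      have A: "?A = {k\<in>C. \<forall>c. fence_le (q c) (d k c)}"
        using C(3) le_iff[OF True] by (auto simp: q_def)
      \<comment> \<open>Along a chain the sets \<open>?Ac c\<close> are up-sets, hence nested, and
        their intersection \<open>?A\<close> is attained at one coordinate: one where the largest
        element outside \<open>?A\<close> fails, since all smaller elements fail there too.\<close>
      have "\<exists>c. ?Ac c \<subseteq> ?A"
      proof (cases "?A = C")
        case True
        then show ?thesis by blast
      next
        case False
        have "C - ?A \<in> Chains vert_le" using C(4) by (auto simp: Chains_def)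
        then obtain t where t: "t \<in> C - ?A" "\<And>k. k \<in> C - ?A \<Longrightarrow> (k, t) \<in> vert_le"
          using finite_chain_greatest[of "C - ?A" vert_le] C(1) False trans by blast
        then obtain c where c: "\<not> fence_le (q c) (d t c)" using A by blast
        have "\<not> fence_le (q c) (d k c)" if "k \<in> C - ?A" for k
        proof
          assume "fence_le (q c) (d k c)"
          moreover have "fence_le (d k c) (d t c)" using that t C(3) le_iff by blast
          ultimately show False using c fence_le_trans by blast
        qed
        then show ?thesis by blast
      qed
      then obtain c where c: "?Ac c \<subseteq> ?A" by blast
      have "coord x q \<le> sum w ?A"
      proof -
        have "coord x q \<le> sum w (?Ac c)" using coord_le[of x q c] by (simp add: hat_x)
        also have "\<dots> \<le> sum w ?A" using c C(1) w by (intro sum_mono2) auto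
        finally show ?thesis .
      qed
      moreover have "sum w ?A \<le> coord x q"
        unfolding coord_ge_iff hat_x A using C(1) w by (intro allI sum_mono2) auto
      ultimately have "coord x q = sum w ?A" by simp
      then show ?thesis unfolding apply_embed[OF xp] fw using True by (simp add: embed_fun_def q_def d_def)
    qed
  qed
  then show ?thesis using xp by blast
qed

lemma bij_betw_embed: "bij_betw embed points (geometric_realization vert vert_le)"
proof (rule bij_betw_imageI)
  show "inj_on embed points"
  proof (rule inj_onI)
    fix x y assume xy: "x \<in> points" "y \<in> points" "embed x = embed y"
    have "x c = y c" for c
      using embed_inverse_lipschitz[OF xy(1,2), of c] xy(3) by simp
    then show "x = y" by blast
  qed
  show "embed ` points = geometric_realization vert vert_le"
    using embed_mem embed_surj by blast
qed

lemma uniform_polyhedron_realization: "uniform_polyhedron (geometric_realization vert vert_le)"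
  unfolding uniform_polyhedron_def
  using partial_order_vert conditionally_complete_vert by blast

end

section \<open>Finitely supported maps on separable uniform spaces\<close>

fun entourage_path :: "(nat \<Rightarrow> 'a \<times> 'a \<Rightarrow> bool) \<Rightarrow> 'a \<Rightarrow> (nat \<times> 'a) list \<Rightarrow> 'a \<Rightarrow> bool" where
  "entourage_path V x [] y \<longleftrightarrow> x = y"
| "entourage_path V x ((n, z) # l) y \<longleftrightarrow> V n (x, z) \<and> entourage_path V z l y"

text \<open>A step through the \<open>n\<close>-th entourage costs \<open>(1/2) ^ n\<close>; the
  infimum over all paths is the pseudometric of the classical metrization argument.\<close>

definition path_weight :: "(nat \<times> 'a) list \<Rightarrow> real" where
  "path_weight l = (\<Sum>(n, z)\<leftarrow>l. (1/2) ^ n)"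

lemma path_weight_simps [simp]:
  "path_weight [] = 0"
  "path_weight (s # l) = (1/2) ^ fst s + path_weight l"
  "path_weight (l @ l') = path_weight l + path_weight l'"
  by (simp_all add: path_weight_def case_prod_unfold)

lemma path_weight_nonneg [simp]: "0 \<le> path_weight l"
  by (induction l) auto

lemma entourage_path_append:
  "entourage_path V x (l @ l') z \<longleftrightarrow> (\<exists>y. entourage_path V x l y \<and> entourage_path V y l' z)"
  by (induction l arbitrary: x) auto

lemma entourage_path_sym:
  assumes sym: "\<And>n x y. V n (x, y) \<Longrightarrow> V n (y, x)" and "entourage_path V x l y"
  shows "\<exists>l'. entourage_path V y l' x \<and> path_weight l' = path_weight l"
  using assms(2)
proof (induction l arbitrary: x)
  case Nil
  then show ?case by (intro exI[of _ "[]"]) simp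
next
  case (Cons s l)
  obtain n z where s: "s = (n, z)" by (cases s)
  obtain l' where "entourage_path V y l' z" "path_weight l' = path_weight l"
    using Cons s by auto
  then show ?case using Cons.prems s sym
    by (intro exI[of _ "l' @ [(n, x)]"]) (auto simp: entourage_path_append)
qed

lemma path_weight_split:
  assumes "l \<noteq> []" "0 \<le> t" "t \<le> path_weight l"
  shows "\<exists>l1 s l2. l = l1 @ s # l2 \<and> path_weight l1 \<le> t \<and> t \<le> path_weight (l1 @ [s])"
  using assms
proof (induction l arbitrary: t)
  case (Cons a l)
  show ?case
  proof (cases "t \<le> (1/2) ^ fst a")
    case True
    then show ?thesis using Cons.prems by (intro exI[of _ "[]"] exI[of _ a] exI[of _ l]) simp
  next
    case False
    then have "l \<noteq> []" "0 \<le> t - (1/2) ^ fst a" "t - (1/2) ^ fst a \<le> path_weight l"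
      using Cons.prems by auto
    from Cons.IH[OF this] obtain l1 s l2 where "l = l1 @ s # l2" "path_weight l1 \<le> t - (1/2) ^ fst a"
      "t - (1/2) ^ fst a \<le> path_weight (l1 @ [s])"
      by blast
    then show ?thesis by (intro exI[of _ "a # l1"] exI[of _ s] exI[of _ l2]) simp
  qed
qed simp

text \<open>
  The path is cut at the step where half of its weight is reached; the parts before and after have
  at most half the weight, and the step itself is short.
\<close>

lemma entourage_path_shortcut:
  assumes refl: "\<And>n x. V n (x, x)"
    and cube: "\<And>n x y z w. V (Suc n) (x, y) \<Longrightarrow> V (Suc n) (y, z) \<Longrightarrow> V (Suc n) (z, w) \<Longrightarrow> V n (x, w)"
    and "entourage_path V x l y" "path_weight l < (1/2) ^ n"
  shows "V n (x, y)"
  using assms(3,4)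
proof (induction "length l" arbitrary: l x y n rule: less_induct)
  case less
  show ?case
  proof (cases "l = []")
    case True
    then show ?thesis using less.prems refl by simp
  next
    case False
    let ?r = "path_weight l"
    obtain l1 s l2 where l: "l = l1 @ s # l2" "path_weight l1 \<le> ?r / 2" "?r / 2 \<le> path_weight (l1 @ [s])"
      using path_weight_split[OF False, of "?r / 2"] by auto
    obtain m b where s: "s = (m, b)" by (cases s)
    obtain a where a: "entourage_path V x l1 a" "V m (a, b)" "entourage_path V b l2 y"
      using less.prems l s by (auto simp: entourage_path_append)
    have half: "?r / 2 < (1/2) ^ Suc n" using less.prems by simp
    have "V (Suc n) (x, a)"
      using less.hyps[of l1 x a "Suc n"] l a half by simp
    moreover have "V (Suc n) (b, y)"
      using less.hyps[of l2 b y "Suc n"] l a half by simp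
    moreover have "V (Suc n) (a, b)"
    proof -
      have "(1/2 :: real) ^ m \<le> ?r" using l(1) s by simp
      then have "(1/2 :: real) ^ m < (1/2) ^ n" using less.prems by linarith
      then have "Suc n \<le> m" by (simp add: power_strict_decreasing_iff Suc_le_eq)
      moreover have "V k (a, b)" if "V (Suc k) (a, b)" for k
        using cube[OF that refl refl] .
      ultimately show ?thesis using a(2)
        by (induction m rule: dec_induct) blast+
    qed
    ultimately show ?thesis using cube by blast
  qed
qed

lemma entourage_cube_root:
  fixes E :: "'a::uniform_space \<times> 'a \<Rightarrow> bool"
  assumes "eventually E uniformity"
  obtains D where "eventually D uniformity" "\<And>x y. D (x, y) \<Longrightarrow> D (y, x)"
    "\<And>x y z w. D (x, y) \<Longrightarrow> D (y, z) \<Longrightarrow> D (z, w) \<Longrightarrow> E (x, w)"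
proof -
  obtain D1 where D1: "eventually D1 uniformity" "\<And>x y z. D1 (x, y) \<Longrightarrow> D1 (y, z) \<Longrightarrow> E (x, z)"
    using uniformity_trans[OF assms] by blast
  obtain D2 where D2: "eventually D2 uniformity" "\<And>x y z. D2 (x, y) \<Longrightarrow> D2 (y, z) \<Longrightarrow> D1 (x, z)"
    using uniformity_trans[OF D1(1)] by blast
  define D where "D p \<longleftrightarrow> D2 p \<and> D2 (prod.swap p)" for p
  have "eventually (\<lambda>(x, y). D2 (y, x)) uniformity" using D2(1) by (rule uniformity_sym)
  then have "eventually D uniformity"
    using D2(1) unfolding D_def by eventually_elim auto
  moreover have "D (x, y) \<Longrightarrow> D (y, x)" for x y by (simp add: D_def)
  moreover have "E (x, w)" if "D (x, y)" "D (y, z)" "D (z, w)" for x y z w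
  proof -
    \<comment> \<open>Halving twice leaves room for four links; the reflexive pair is the
      fourth.\<close>
    have "D2 (w, w)" using D2(1) by (rule uniformity_refl)
    then show ?thesis using that D1(2) D2(2) unfolding D_def by blast
  qed
  ultimately show ?thesis by (rule that)
qed

lemma entourage_pseudometric:
  fixes E :: "'a::uniform_space \<times> 'a \<Rightarrow> bool"
  assumes E: "eventually E uniformity"
  obtains d :: "'a \<Rightarrow> 'a \<Rightarrow> real" where
    "\<And>x y. 0 \<le> d x y" "\<And>x. d x x = 0" "\<And>x y. d x y = d y x" "\<And>x y z. d x z \<le> d x y + d y z"
    "\<And>e. 0 < e \<Longrightarrow> eventually (\<lambda>(x, y). d x y < e) uniformity"
    "\<And>x y. d x y < 1/2 \<Longrightarrow> E (x, y)"
proof -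
  define good where "good D \<longleftrightarrow> eventually D uniformity \<and> (\<forall>x y. D (x, y) \<longrightarrow> D (y, x))
      \<and> (\<forall>x y. D (x, y) \<longrightarrow> E (x, y))" for D :: "'a \<times> 'a \<Rightarrow> bool"
  define below where "below D D' \<longleftrightarrow> (\<forall>x y z w. D' (x, y) \<longrightarrow> D' (y, z) \<longrightarrow> D' (z, w) \<longrightarrow> D (x, w))"
    for D D' :: "'a \<times> 'a \<Rightarrow> bool"
  have next_D: "\<exists>D'. good D' \<and> below D D'"
    if D_ev: "eventually D uniformity" and D_E: "\<forall>x y. D (x, y) \<longrightarrow> E (x, y)" for D
  proof -
    obtain D' where D': "eventually D' uniformity" "\<And>x y. D' (x, y) \<Longrightarrow> D' (y, x)"
      "\<And>x y z w. D' (x, y) \<Longrightarrow> D' (y, z) \<Longrightarrow> D' (z, w) \<Longrightarrow> D (x, w)"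
      by (rule entourage_cube_root[OF D_ev]) (rule that)
    have "D' (x, x)" for x using D'(1) by (rule uniformity_refl)
    then show ?thesis using D' D_E unfolding good_def below_def by blast
  qed
  have "\<exists>U. \<forall>n. good (U n) \<and> below (U n) (U (Suc n))"
  proof (rule dependent_nat_choice)
    show "\<exists>D. good D" using next_D[OF E] by blast
    show "\<exists>D'. good D' \<and> below D D'" if "good D" for D
      using next_D[of D] that unfolding good_def by blast
  qed
  then obtain U where U: "\<forall>n. good (U n)" "\<forall>n. below (U n) (U (Suc n))" by blast
  \<comment> \<open>The trivial relation at index 0 joins any two points in one step, so the infimum
    is over a nonempty set. The shift also explains the threshold 1/2: weight below
    \<open>(1/2) ^ 1\<close> yields \<open>V 1\<close>, which is contained in
    \<open>E\<close>.\<close>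
  define V where "V n = (case n of 0 \<Rightarrow> (\<lambda>_. True) | Suc m \<Rightarrow> U m)" for n
  have V_ev: "eventually (V n) uniformity" for n
    using U(1) by (cases n) (auto simp: V_def good_def)
  have V_refl: "V n (x, x)" for n x using V_ev by (rule uniformity_refl)
  have V_sym: "V n (x, y) \<Longrightarrow> V n (y, x)" for n x y
    using U(1) by (cases n) (auto simp: V_def good_def)
  have V_cube: "V (Suc n) (x, y) \<Longrightarrow> V (Suc n) (y, z) \<Longrightarrow> V (Suc n) (z, w) \<Longrightarrow> V n (x, w)" for n x y z w
    using U(2) by (cases n) (auto simp: V_def below_def)
  define W where "W x y = {path_weight l | l. entourage_path V x l y}" for x y
  define d where "d x y = Inf (W x y)" for x y
  have W_ne: "W x y \<noteq> {}" for x y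
  proof -
    have "entourage_path V x [(0, y)] y" by (simp add: V_def)
    then show ?thesis unfolding W_def by blast
  qed
  have W_bdd: "bdd_below (W x y)" for x y
    by (rule bdd_belowI[of _ 0]) (auto simp: W_def)
  have d_le: "d x y \<le> path_weight l" if "entourage_path V x l y" for x y l
    unfolding d_def using that W_bdd by (intro cInf_lower) (auto simp: W_def)
  have d_geI: "a \<le> d x y" if "\<And>l. entourage_path V x l y \<Longrightarrow> a \<le> path_weight l" for a x y
    unfolding d_def using that W_ne by (intro cInf_greatest) (auto simp: W_def)
  show ?thesis
  proof (rule that[of d])
    show d0: "0 \<le> d x y" for x y by (intro d_geI) simp
    show "d x x = 0" for x using d0[of x x] d_le[of x "[]" x] by simp
    have "d x y \<le> d y x" for x y
    proof (rule d_geI)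
      fix l assume "entourage_path V y l x"
      then obtain l' where "entourage_path V x l' y" "path_weight l' = path_weight l"
        using entourage_path_sym[of V, OF V_sym] by blast
      then show "d x y \<le> path_weight l" using d_le by metis
    qed
    then show "d x y = d y x" for x y by (intro antisym)
    show "d x z \<le> d x y + d y z" for x y z
    proof -
      have "d x z - path_weight l \<le> d y z" if l: "entourage_path V x l y" for l
      proof (rule d_geI)
        fix l' assume "entourage_path V y l' z"
        then have "entourage_path V x (l @ l') z" using l by (auto simp: entourage_path_append)
        from d_le[OF this] show "d x z - path_weight l \<le> path_weight l'" by simp
      qed
      then have "d x z - d y z \<le> d x y" by (intro d_geI) (simp add: algebra_simps)
      then show ?thesis by simp
    qed
    show "eventually (\<lambda>(x, y). d x y < e) uniformity" if e: "0 < e" for e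
    proof -
      obtain n where n: "(1/2 :: real) ^ n < e" using real_arch_pow_inv[OF e, of "1/2"] by auto
      have "d x y < e" if "V n (x, y)" for x y
        using d_le[of x "[(n, y)]" y] that n by simp
      then show ?thesis using V_ev[of n] by (auto elim: eventually_mono)
    qed
    show "E (x, y)" if "d x y < 1/2" for x y
    proof -
      obtain l where "entourage_path V x l y" "path_weight l < (1/2) ^ 1"
        using cInf_lessD[OF W_ne, of x y "1/2"] \<open>d x y < 1/2\<close> by (auto simp: d_def W_def)
      then have "V 1 (x, y)"
        by (rule entourage_path_shortcut[where V = V, rotated 2]) (rule V_refl, rule V_cube)
      then show ?thesis using U(1) by (simp add: V_def good_def)
    qed
  qed
qed

text \<open>
  The sets \<open>B(a k, 3e) - (\<Union>i<k. B(a i, e))\<close> form a point-finite cover with Lebesgue number \<open>e\<close>; the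
  \<open>k\<close>-th coordinate of the map below is a Lipschitz function that is positive only on the \<open>k\<close>-th set.
\<close>

lemma separable_finitely_supported_map:
  fixes S :: "'a::uniform_space set"
  assumes S: "separable_space (top_of_set S)" and E: "eventually E uniformity"
  obtains f :: "'a \<Rightarrow> nat \<Rightarrow> real" and \<epsilon> :: real where
    "\<And>x k. 0 \<le> f x k" "\<And>x. x \<in> S \<Longrightarrow> finite {k. f x k \<noteq> 0}"
    "\<And>e. 0 < e \<Longrightarrow> eventually (\<lambda>(x, y). \<forall>k. \<bar>f x k - f y k\<bar> < e) uniformity"
    "0 < \<epsilon>" "\<And>x y. x \<in> S \<Longrightarrow> (\<And>k. \<bar>f x k - f y k\<bar> < \<epsilon>) \<Longrightarrow> E (x, y)"
proof -
  obtain d :: "'a \<Rightarrow> 'a \<Rightarrow> real" where d0: "\<And>x y. 0 \<le> d x y"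
    and d_refl: "\<And>x. d x x = 0" and dsym: "\<And>x y. d x y = d y x"
    and tri: "\<And>x y z. d x z \<le> d x y + d y z"
    and dev: "\<And>e. 0 < e \<Longrightarrow> eventually (\<lambda>(x, y). d x y < e) uniformity"
    and dE: "\<And>x y. d x y < 1/2 \<Longrightarrow> E (x, y)"
    by (rule entourage_pseudometric[OF E]) (rule that)
  obtain C where C: "countable C" "C \<subseteq> S" "top_of_set S closure_of C = S"
    using S unfolding separable_space_def by auto
  define a where "a = from_nat_into C"
  have dense: "\<exists>k. d x (a k) < e" if "x \<in> S" "0 < e" for x e
  proof -
    have "eventually (\<lambda>y. d x y < e) (nhds x)"
      unfolding eventually_nhds_uniformity using dev[OF that(2)] by (auto elim: eventually_mono)
    then obtain T where T: "open T" "x \<in> T" "\<And>y. y \<in> T \<Longrightarrow> d x y < e"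
      unfolding eventually_nhds by blast
    have "x \<in> top_of_set S closure_of C" using C(3) that by simp
    then obtain y where "y \<in> C" "y \<in> S \<inter> T"
      using T(1,2) that(1) by (auto simp: in_closure_of dest!: spec[of _ "S \<inter> T"])
    then show ?thesis using T(3) from_nat_into_surj[OF C(1)] unfolding a_def by (metis IntE)
  qed
  \<comment> \<open>The final estimate adds \<open>2 * ?e\<close> and \<open>3 * ?e\<close>; their
    sum is the threshold 1/2 of the pseudometric.\<close>
  let ?e = "1/10 :: real"
  define H where "H x k = insert (3 * ?e - d x (a k)) ((\<lambda>i. d x (a i) - ?e) ` {..<k})" for x k
  define f where "f x k = max 0 (Min (H x k))" for x k
  have H: "finite (H x k)" "H x k \<noteq> {}" for x k by (simp_all add: H_def)
  have Min_H: "Min (H x k) - d x y \<le> Min (H y k)" for x y k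
  proof -
    have "Min (H x k) - d x y \<le> t" if "t \<in> H y k" for t
    proof -
      obtain s where s: "s \<in> H x k" "s - d x y \<le> t"
      proof (cases "t = 3 * ?e - d y (a k)")
        case True
        then show ?thesis using tri[of y "a k" x] dsym[of x y]
          by (intro that[of "3 * ?e - d x (a k)"]) (auto simp: H_def)
      next
        case False
        then obtain i where "i < k" "t = d y (a i) - ?e" using \<open>t \<in> H y k\<close> by (auto simp: H_def)
        then show ?thesis using tri[of x "a i" y]
          by (intro that[of "d x (a i) - ?e"]) (auto simp: H_def)
      qed
      have "Min (H x k) \<le> s" using H s by simp
      then show ?thesis using s by linarith
    qed
    then show ?thesis using H by simp
  qed
  have lip: "\<bar>f x k - f y k\<bar> \<le> d x y" for x y k
    using Min_H[of x k y] Min_H[of y k x] dsym[of x y] d0[of x y] unfolding f_def by linarith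
  show ?thesis
  proof (rule that[of f ?e])
    show "0 \<le> f x k" for x k by (simp add: f_def)
    show "finite {k. f x k \<noteq> 0}" if "x \<in> S" for x
    proof -
      \<comment> \<open>Once \<open>a m\<close> is within \<open>?e\<close> of \<open>x\<close>, its
        entry in \<open>H x k\<close> is negative for every later \<open>k\<close>.\<close>
      obtain m where m: "d x (a m) < ?e" using dense[OF \<open>x \<in> S\<close>, of ?e] by auto
      have "f x k = 0" if "m < k" for k
      proof -
        have "d x (a m) - ?e \<in> H x k" using that by (auto simp: H_def)
        then have "Min (H x k) \<le> d x (a m) - ?e" using H by simp
        then show ?thesis using m by (simp add: f_def)
      qed
      then have "{k. f x k \<noteq> 0} \<subseteq> {..m}" by (auto simp: not_less[symmetric])
      then show ?thesis by (rule finite_subset) simp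
    qed
    show "eventually (\<lambda>(x, y). \<forall>k. \<bar>f x k - f y k\<bar> < e) uniformity" if "0 < e" for e
      using dev[OF that] le_less_trans[OF lip] by (auto elim!: eventually_mono)
    show "E (x, y)" if "x \<in> S" and close: "\<And>k. \<bar>f x k - f y k\<bar> < ?e" for x y
    proof -
      \<comment> \<open>The first centre within \<open>2 * ?e\<close> of \<open>x\<close>: the
        earlier ones are at least that far, so every entry of \<open>H x n\<close> is at least
        \<open>?e\<close>. A change below \<open>?e\<close> leaves \<open>f y n\<close> positive,
        which places \<open>y\<close> within \<open>3 * ?e\<close> of the same centre.\<close>
      define n where "n = (LEAST k. d x (a k) < 2 * ?e)"
      have n: "d x (a n) < 2 * ?e" unfolding n_def
        by (rule LeastI_ex) (rule dense[OF \<open>x \<in> S\<close>], simp)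
      have before: "2 * ?e \<le> d x (a i)" if "i < n" for i
        using not_less_Least[of i "\<lambda>k. d x (a k) < 2 * ?e"] that unfolding n_def by linarith
      have "?e \<le> t" if "t \<in> H x n" for t
        using that n before by (fastforce simp: H_def)
      then have "?e \<le> Min (H x n)" using H by (intro Min.boundedI)
      then have "?e \<le> f x n" by (simp add: f_def)
      then have "0 < f y n" using close[of n] by linarith
      then have "0 < Min (H y n)" by (simp add: f_def)
      moreover have "Min (H y n) \<le> 3 * ?e - d y (a n)" using H by (intro Min_le) (auto simp: H_def)
      ultimately have "d y (a n) < 3 * ?e" by linarith
      then have "d x y < 1/2" using n tri[of x y "a n"] dsym[of y "a n"] by linarith
      then show ?thesis by (rule dE)
    qed
  qed simp
qed

section \<open>Cubical neighbourhoods of the image\<close>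

lemma hat_carrier_exists:
  assumes "0 \<le> t"
  shows "\<exists>p. \<forall>m. 0 < hat m t \<longleftrightarrow> fence_le m p"
proof -
  \<comment> \<open>There are finitely many hat values at \<open>t\<close>, so positivity is the
    superlevel condition at the least positive one.\<close>
  let ?V = "range (\<lambda>m. hat m t) - {0}"
  have fin: "finite ?V" using finite_hat_values[OF assms] by simp
  obtain m where "hat m t = 1" using hat_eq_1_exists[OF assms] by blast
  then have one: "1 \<in> ?V" by (auto intro!: rev_image_eqI[of m])
  have "Min ?V \<in> ?V" using fin one by (intro Min_in) auto
  then have pos: "0 < Min ?V" using hat_nonneg by (force simp: less_le)
  have "Min ?V \<le> 1" using fin one by simp
  then obtain p where p: "\<forall>m. Min ?V \<le> hat m t \<longleftrightarrow> fence_le m p"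
    using hat_superlevel_principal[OF assms pos] by blast
  have "0 < hat m t \<longleftrightarrow> Min ?V \<le> hat m t" for m
    using pos fin by (auto intro!: Min_le)
  then show ?thesis using p by blast
qed

text \<open>\<open>t\<close> lies in the closure of the open face (integer point or open edge of the fence) of \<open>u\<close>.\<close>

definition carrier_le :: "real \<Rightarrow> real \<Rightarrow> bool" where
  "carrier_le t u \<longleftrightarrow> (\<forall>m. 0 < hat m t \<longrightarrow> 0 < hat m u)"

lemma carrier_le_refl [simp]: "carrier_le t t"
  by (simp add: carrier_le_def)

text \<open>Some hat is positive at both points, and each lies within 2 of its centre.\<close>

lemma carrier_le_imp_dist:
  assumes "carrier_le t u" "0 \<le> t"
  shows "\<bar>t - u\<bar> \<le> 4"
proof -
  obtain m where "hat m t = 1" using hat_eq_1_exists assms(2) by blast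
  then have "0 < hat m t" by simp
  then show ?thesis
    using hat_pos_imp_dist[of m t] hat_pos_imp_dist[of m u] assms(1) unfolding carrier_le_def by fastforce
qed

lemma hat_pos_even: "even m \<Longrightarrow> 0 < hat m t \<longleftrightarrow> \<bar>t - real m\<bar> < 2"
  and hat_pos_odd: "odd m \<Longrightarrow> 0 < hat m t \<longleftrightarrow> \<bar>t - real m\<bar> < 1"
  by (auto simp: hat_def)

text \<open>In the doubled coordinate, the region where \<open>hat m\<close> is positive is covered
  by open stars of even vertices: that of \<open>2 * m\<close> for odd \<open>m\<close>, and those
  of \<open>2 * m - 2\<close>, \<open>2 * m\<close>, \<open>2 * m + 2\<close> for even
  \<open>m\<close>. The hypothesis carries each star from \<open>2 * t\<close> to
  \<open>2 * u\<close>. Nonnegativity excludes \<open>m = 0\<close> where the star on the left would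
  be needed.\<close>

lemma carrier_le_halve:
  assumes le: "carrier_le (2 * t) (2 * u)" and t: "0 \<le> t"
  shows "carrier_le t u"
  unfolding carrier_le_def
proof (intro allI impI)
  fix m assume m: "0 < hat m t"
  have star: "\<bar>2 * u - real k\<bar> < 2" if "even k" "\<bar>2 * t - real k\<bar> < 2" for k
    using le that hat_pos_even unfolding carrier_le_def by blast
  show "0 < hat m u"
  proof (cases "even m")
    case False
    then show ?thesis using m star[of "2 * m"] by (simp add: hat_pos_odd abs_less_iff)
  next
    case True
    then have tm: "\<bar>t - real m\<bar> < 2" using m by (simp add: hat_pos_even)
    consider "t < real m" | "t = real m" | "real m < t" by linarith
    then have "\<bar>u - real m\<bar> < 2"
    proof cases
      case 1
      then have "m \<noteq> 0" using t by (intro notI) simp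
      then obtain j where "m = Suc j" using not0_implies_Suc by blast
      then show ?thesis using star[of "2 * j"] 1 tm by (simp add: abs_less_iff)
    next
      case 2
      then show ?thesis using star[of "2 * m"] by (simp add: abs_less_iff)
    next
      case 3
      then show ?thesis using star[of "2 * m + 2"] tm by (simp add: abs_less_iff)
    qed
    then show ?thesis using True by (simp add: hat_pos_even)
  qed
qed

lemma carrier_le_coarsen:
  assumes "n \<le> m" "0 \<le> t" "carrier_le (2 ^ m * t) (2 ^ m * u)"
  shows "carrier_le (2 ^ n * t) (2 ^ n * u)"
  using assms(1,3)
proof (induction m rule: dec_induct)
  case (step m)
  have "carrier_le (2 * (2 ^ m * t)) (2 * (2 ^ m * u))" using step.prems by (simp add: mult.assoc)
  then show ?case using carrier_le_halve assms(2) step.IH by simp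
qed

section \<open>Cubical neighbourhoods and their face posets\<close>

lemma countable_finite_support:
  assumes "countable D"
  shows "countable {p :: 'c \<Rightarrow> nat. finite {c. p c \<noteq> 0} \<and> {c. p c \<noteq> 0} \<subseteq> D}" (is "countable ?Q")
proof -
  define G where "G p = {(c, p c) | c. p c \<noteq> 0}" for p :: "'c \<Rightarrow> nat"
  have "inj_on G ?Q"
  proof (rule inj_onI)
    fix p q assume eq: "G p = G q"
    have "p c = m \<longleftrightarrow> (c, m) \<in> G p" "q c = m \<longleftrightarrow> (c, m) \<in> G q" if "m \<noteq> 0" for c m
      using that by (auto simp: G_def)
    then have "p c = m \<longleftrightarrow> q c = m" if "m \<noteq> 0" for c m using eq that by blast
    then have "p c = q c" for c by (metis (full_types))
    then show "p = q" by blast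
  qed
  moreover have "G ` ?Q \<subseteq> {A. finite A \<and> A \<subseteq> D \<times> UNIV}"
  proof safe
    fix p :: "'c \<Rightarrow> nat" assume "finite {c. p c \<noteq> 0}" "{c. p c \<noteq> 0} \<subseteq> D"
    moreover have "G p = (\<lambda>c. (c, p c)) ` {c. p c \<noteq> 0}" by (auto simp: G_def)
    ultimately show "finite (G p)" by simp
  qed (auto simp: G_def)
  then have "countable (G ` ?Q)"
    using countable_Collect_finite_subset[of "D \<times> (UNIV :: nat set)"] assms
    by (meson countable_SIGMA countable_subset countableI_type)
  ultimately show ?thesis using countable_image_inj_on by blast
qed

text \<open>Positivity of all the hats says that \<open>p\<close> is a face of the carrier of the
  scaled image of \<open>s\<close>. Faces are thus included from the start, and one \<open>s\<close>
  must serve all coordinates.\<close>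

definition cubes_near :: "'a set \<Rightarrow> ('a \<Rightarrow> nat \<Rightarrow> real) set \<Rightarrow> nat \<Rightarrow> (('a \<Rightarrow> nat \<Rightarrow> real) \<times> nat \<Rightarrow> nat) set" where
  "cubes_near S F n = {p. finite {c. p c \<noteq> 0} \<and> {c. p c \<noteq> 0} \<subseteq> F \<times> UNIV \<and>
     (\<exists>s\<in>S. \<forall>f\<in>F. \<forall>k. 0 < hat (p (f, k)) (2 ^ n * f s k))}"

definition cubical_nbhd :: "'a set \<Rightarrow> ('a \<Rightarrow> nat \<Rightarrow> real) set \<Rightarrow> nat \<Rightarrow> (('a \<Rightarrow> nat \<Rightarrow> real) \<times> nat \<Rightarrow> real) set" where
  "cubical_nbhd S F n = {x. (\<forall>c. 0 \<le> x c) \<and> finite {c. x c \<noteq> 0} \<and> {c. x c \<noteq> 0} \<subseteq> F \<times> UNIV \<and>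
     (\<exists>s\<in>S. \<forall>f\<in>F. \<forall>k. carrier_le (2 ^ n * x (f, k)) (2 ^ n * f s k))}"

lemma fence_complex_cubes_near:
  assumes "finite F"
  shows "fence_complex (cubes_near S F n)"
proof
  have "cubes_near S F n \<subseteq> {p. finite {c. p c \<noteq> 0} \<and> {c. p c \<noteq> 0} \<subseteq> F \<times> UNIV}"
    by (auto simp: cubes_near_def)
  moreover have "countable (F \<times> (UNIV :: nat set))"
    using countable_finite[OF assms] by (intro countable_SIGMA) auto
  ultimately show "countable (cubes_near S F n)"
    using countable_finite_support countable_subset by blast
  show "finite {c. p c \<noteq> 0}" if "p \<in> cubes_near S F n" for p
    using that by (simp add: cubes_near_def)
  show "p \<in> cubes_near S F n" if q: "q \<in> cubes_near S F n" and le: "\<And>c. fence_le (p c) (q c)" for p q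
  proof -
    \<comment> \<open>Only 0 lies below 0 in the fence.\<close>
    have supp: "{c. p c \<noteq> 0} \<subseteq> {c. q c \<noteq> 0}"
      using le by (metis (mono_tags, lifting) Collect_mono fence_le_0_iff)
    obtain s where s: "s \<in> S" "\<forall>f\<in>F. \<forall>k. 0 < hat (q (f, k)) (2 ^ n * f s k)"
      using q by (auto simp: cubes_near_def)
    have "0 < hat (p (f, k)) (2 ^ n * f s k)" if "f \<in> F" for f k
      using s(2) that hat_antimono[OF le] less_le_trans by blast
    moreover have "finite {c. p c \<noteq> 0}" "{c. p c \<noteq> 0} \<subseteq> F \<times> UNIV"
      using supp q finite_subset unfolding cubes_near_def by blast+
    ultimately show ?thesis using s(1) unfolding cubes_near_def by blast
  qed
qed

lemma scaled_mem_points_iff: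
  assumes "finite F"
  shows "(\<lambda>c. 2 ^ n * x c) \<in> fence_complex.points (cubes_near S F n) \<longleftrightarrow> x \<in> cubical_nbhd S F n"
proof -
  interpret fence_complex "cubes_near S F n" using assms by (rule fence_complex_cubes_near)
  let ?x = "\<lambda>c. 2 ^ n * x c"
  have nn: "0 \<le> ?x c \<longleftrightarrow> 0 \<le> x c" for c
    using zero_less_power[of "2::real" n] by (simp add: zero_le_mult_iff del: zero_less_power)
  show ?thesis
  proof
    assume x: "x \<in> cubical_nbhd S F n"
    then obtain s where s: "s \<in> S" "\<forall>f\<in>F. \<forall>k. carrier_le (?x (f, k)) (2 ^ n * f s k)"
      by (auto simp: cubical_nbhd_def)
    have "q \<in> cubes_near S F n" if q: "\<forall>c. 0 < hat (q c) (?x c)" for q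
    proof -
      have "q c = 0" if "x c = 0" for c
      proof -
        have "0 < hat (q c) (real 0)" using q[rule_format, of c] that by simp
        then show ?thesis unfolding hat_of_nat_pos_iff by simp
      qed
      then have supp: "{c. q c \<noteq> 0} \<subseteq> {c. x c \<noteq> 0}" by auto
      have "0 < hat (q (f, k)) (2 ^ n * f s k)" if "f \<in> F" for f k
        using q[rule_format, of "(f, k)"] s(2)[rule_format, OF that, of k]
        unfolding carrier_le_def by simp
      moreover have "finite {c. q c \<noteq> 0}" "{c. q c \<noteq> 0} \<subseteq> F \<times> UNIV"
        using supp x finite_subset unfolding cubical_nbhd_def by blast+
      ultimately show ?thesis using s(1) unfolding cubes_near_def by blast
    qed
    then show "?x \<in> points"
      using x nn unfolding points_def cubical_nbhd_def by simp
  next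
    assume xp: "?x \<in> points"
    then have x0: "\<And>c. 0 \<le> ?x c" and fin: "finite {c. x c \<noteq> 0}"
      by (simp_all add: points_def del: split_paired_All)
    have "\<forall>c. \<exists>p. \<forall>m. 0 < hat m (?x c) \<longleftrightarrow> fence_le m p"
      using hat_carrier_exists x0 by blast
    then obtain q where q: "\<And>c m. 0 < hat m (?x c) \<longleftrightarrow> fence_le m (q c)" by metis
    then have "\<forall>c. 0 < hat (q c) (?x c)" by (simp del: split_paired_All)
    then have qP: "q \<in> cubes_near S F n" using xp by (simp add: points_def del: split_paired_All)
    then obtain s where s: "s \<in> S" "\<forall>f\<in>F. \<forall>k. 0 < hat (q (f, k)) (2 ^ n * f s k)"
      by (auto simp: cubes_near_def)
    \<comment> \<open>The carrier \<open>q\<close> inherits its support condition from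
      \<open>cubes_near\<close>; a coordinate with carrier 0 must be 0, since every point of the
      open first edge has a positive \<open>hat 1\<close>.\<close>
    have "x c = 0" if "q c = 0" for c
    proof -
      have "0 < hat 0 (?x c)" "\<not> 0 < hat 1 (?x c)" using q[of _ c] that by simp_all
      then have "?x c = 0" using x0[of c] by (simp add: hat_pos_even hat_pos_odd abs_if split: if_splits)
      then show ?thesis by simp
    qed
    then have "{c. x c \<noteq> 0} \<subseteq> F \<times> UNIV" using qP unfolding cubes_near_def by blast
    moreover have "carrier_le (?x (f, k)) (2 ^ n * f s k)" if "f \<in> F" for f k
      unfolding carrier_le_def using q s(2) that hat_antimono less_le_trans by blast
    ultimately show "x \<in> cubical_nbhd S F n"
      using s(1) fin x0 nn unfolding cubical_nbhd_def by blast
  qed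
qed

text \<open>The supremum metric on the neighbourhood and the metric of the realization are compared
  in both directions with explicit constants; the factor \<open>2 ^ n\<close> is the scaling of the
  grid to the fence. This is all that later arguments use about the realization.\<close>

lemma cubical_nbhd_polyhedron:
  fixes S :: "'a set" and F :: "('a \<Rightarrow> nat \<Rightarrow> real) set"
  assumes F: "finite F"
  shows "\<exists>(K :: (nat \<Rightarrow>\<^sub>C real) set) \<rho>. uniform_polyhedron K \<and> bij_betw \<rho> (cubical_nbhd S F n) K \<and>
    (\<forall>x\<in>cubical_nbhd S F n. \<forall>y\<in>cubical_nbhd S F n. \<forall>\<delta>.
       (\<forall>c. \<bar>x c - y c\<bar> \<le> \<delta>) \<longrightarrow> dist (\<rho> x) (\<rho> y) \<le> 2 ^ n * \<delta>) \<and>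
    (\<forall>x\<in>cubical_nbhd S F n. \<forall>y\<in>cubical_nbhd S F n.
       dist (\<rho> x) (\<rho> y) < 1/2 \<longrightarrow> (\<forall>c. \<bar>x c - y c\<bar> \<le> 3 * dist (\<rho> x) (\<rho> y)))"
proof -
  interpret fence_complex "cubes_near S F n" using F by (rule fence_complex_cubes_near)
  let ?sc = "\<lambda>x c. 2 ^ n * x c :: real" and ?X = "cubical_nbhd S F n"
  have bij: "bij_betw ?sc ?X points"
  proof (rule bij_betw_imageI)
    show "inj_on ?sc ?X" by (rule inj_onI) (simp add: fun_eq_iff)
    show "?sc ` ?X = points"
    proof
      show "?sc ` ?X \<subseteq> points" using scaled_mem_points_iff[OF F] by blast
      show "points \<subseteq> ?sc ` ?X"
      proof
        fix y assume y: "y \<in> points"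
        have eq: "?sc (\<lambda>c. y c / 2 ^ n) = y" by simp
        then have "(\<lambda>c. y c / 2 ^ n) \<in> ?X" using scaled_mem_points_iff[OF F, of n "\<lambda>c. y c / 2 ^ n" S] y by simp
        then show "y \<in> ?sc ` ?X" using eq by (intro rev_image_eqI[of "\<lambda>c. y c / 2 ^ n"]) simp_all
      qed
    qed
  qed
  then have sc: "?sc x \<in> points" if "x \<in> ?X" for x using that by (auto simp: bij_betw_def)
  have upper: "dist (embed (?sc x)) (embed (?sc y)) \<le> 2 ^ n * \<delta>"
    if "x \<in> ?X" "y \<in> ?X" "\<forall>c. \<bar>x c - y c\<bar> \<le> \<delta>" for x y \<delta>
  proof (rule dist_embed_le[OF sc sc])
    fix c
    have "\<bar>2 ^ n * x c - 2 ^ n * y c\<bar> = 2 ^ n * \<bar>x c - y c\<bar>"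
      by (simp add: abs_mult flip: right_diff_distrib)
    then show "\<bar>2 ^ n * x c - 2 ^ n * y c\<bar> \<le> 2 ^ n * \<delta>"
      using mult_left_mono[OF spec[OF that(3)], of "2 ^ n" c] by simp
  qed (use that in auto)
  have lower: "\<bar>x c - y c\<bar> \<le> 3 * dist (embed (?sc x)) (embed (?sc y))"
    if "x \<in> ?X" "y \<in> ?X" "dist (embed (?sc x)) (embed (?sc y)) < 1/2" for x y c
  proof -
    have "1 * \<bar>x c - y c\<bar> \<le> 2 ^ n * \<bar>x c - y c\<bar>" by (intro mult_right_mono) auto
    also have "\<dots> = \<bar>2 ^ n * x c - 2 ^ n * y c\<bar>"
      by (simp add: abs_mult flip: right_diff_distrib)
    also have "\<dots> \<le> 3 * dist (embed (?sc x)) (embed (?sc y))"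
      using embed_inverse_lipschitz[OF sc sc] that by blast
    finally show ?thesis by simp
  qed
  have "bij_betw (embed \<circ> ?sc) ?X (geometric_realization vert vert_le)"
    using bij bij_betw_embed by (rule bij_betw_trans)
  then show ?thesis
    using uniform_polyhedron_realization upper lower
    by (intro exI[of _ "geometric_realization vert vert_le"] exI[of _ "embed \<circ> ?sc"]) (simp add: o_def)
qed

section \<open>Projections between neighbourhoods and evaluation of points\<close>

definition restrict_coords :: "'f set \<Rightarrow> ('f \<times> nat \<Rightarrow> real) \<Rightarrow> 'f \<times> nat \<Rightarrow> real" where
  "restrict_coords F x c = (if fst c \<in> F then x c else 0)"

text \<open>Coordinates outside \<open>F\<close> are set to zero rather than removed, here and in
  \<open>restrict_coords\<close>, so that the stages for all \<open>F\<close> share one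
  type.\<close>

definition evaluate :: "('a \<Rightarrow> nat \<Rightarrow> real) set \<Rightarrow> 'a \<Rightarrow> ('a \<Rightarrow> nat \<Rightarrow> real) \<times> nat \<Rightarrow> real" where
  "evaluate F s c = (if fst c \<in> F then fst c s (snd c) else 0)"

lemma restrict_coords_restrict: "F \<subseteq> G \<Longrightarrow> restrict_coords F (restrict_coords G x) = restrict_coords F x"
  by (rule ext) (auto simp: restrict_coords_def)

lemma restrict_coords_evaluate: "F \<subseteq> G \<Longrightarrow> restrict_coords F (evaluate G s) = evaluate F s"
  by (rule ext) (auto simp: restrict_coords_def evaluate_def)

lemma restrict_coords_nbhd: "x \<in> cubical_nbhd S F n \<Longrightarrow> restrict_coords F x = x"
  by (rule ext) (auto simp: restrict_coords_def cubical_nbhd_def)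

text \<open>The same \<open>s\<close> serves as a witness, because carrier relations pass to coarser
  grids.\<close>

lemma restrict_coords_mem_nbhd:
  assumes x: "x \<in> cubical_nbhd S G m" and "F \<subseteq> G" "n \<le> m"
  shows "restrict_coords F x \<in> cubical_nbhd S F n"
proof -
  have sub: "{c. restrict_coords F x c \<noteq> 0} \<subseteq> {c. x c \<noteq> 0}" by (auto simp: restrict_coords_def)
  obtain s where s: "s \<in> S" "\<forall>f\<in>G. \<forall>k. carrier_le (2 ^ m * x (f, k)) (2 ^ m * f s k)"
    using x by (auto simp: cubical_nbhd_def)
  have x0: "\<And>c. 0 \<le> x c" and fin: "finite {c. x c \<noteq> 0}"
    using x by (auto simp: cubical_nbhd_def)
  have "carrier_le (2 ^ n * restrict_coords F x (f, k)) (2 ^ n * f s k)" if "f \<in> F" for f k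
    using carrier_le_coarsen[OF \<open>n \<le> m\<close> x0] s(2) that \<open>F \<subseteq> G\<close> by (auto simp: restrict_coords_def)
  moreover have "finite {c. restrict_coords F x c \<noteq> 0}" using sub fin by (rule finite_subset)
  moreover have "{c. restrict_coords F x c \<noteq> 0} \<subseteq> F \<times> UNIV" by (auto simp: restrict_coords_def)
  moreover have "0 \<le> restrict_coords F x c" for c using x0 by (simp add: restrict_coords_def)
  ultimately show ?thesis using s(1) unfolding cubical_nbhd_def by blast
qed

lemma evaluate_mem_nbhd:
  assumes "finite F" "s \<in> S" "\<And>f k. f \<in> F \<Longrightarrow> 0 \<le> f s k" "\<And>f. f \<in> F \<Longrightarrow> finite {k. f s k \<noteq> 0}"
  shows "evaluate F s \<in> cubical_nbhd S F n"
proof -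
  have "{c. evaluate F s c \<noteq> 0} \<subseteq> (\<Union>f\<in>F. Pair f ` {k. f s k \<noteq> 0})"
    by (auto simp: evaluate_def split: if_splits)
  moreover have "finite (\<Union>f\<in>F. Pair f ` {k. f s k \<noteq> 0})" using assms by blast
  ultimately have "finite {c. evaluate F s c \<noteq> 0}" by (rule finite_subset)
  moreover have "\<forall>f\<in>F. \<forall>k. carrier_le (2 ^ n * evaluate F s (f, k)) (2 ^ n * f s k)"
    by (simp add: evaluate_def)
  moreover have "{c. evaluate F s c \<noteq> 0} \<subseteq> F \<times> UNIV" "\<forall>c. 0 \<le> evaluate F s c"
    using assms(3) by (auto simp: evaluate_def)
  ultimately show ?thesis using assms(2) unfolding cubical_nbhd_def by blast
qed

lemma cubical_nbhd_approx:
  assumes "x \<in> cubical_nbhd S F n"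
  shows "\<exists>s\<in>S. \<forall>f\<in>F. \<forall>k. \<bar>x (f, k) - f s k\<bar> \<le> 4 / 2 ^ n"
proof -
  obtain s where s: "s \<in> S" "\<forall>f\<in>F. \<forall>k. carrier_le (2 ^ n * x (f, k)) (2 ^ n * f s k)"
    and x0: "\<And>c. 0 \<le> x c"
    using assms by (auto simp: cubical_nbhd_def)
  have "\<bar>x (f, k) - f s k\<bar> \<le> 4 / 2 ^ n" if "f \<in> F" for f k
  proof -
    have "\<bar>2 ^ n * x (f, k) - 2 ^ n * f s k\<bar> \<le> 4"
      using carrier_le_imp_dist s(2) that x0 by simp
    then have "2 ^ n * \<bar>x (f, k) - f s k\<bar> \<le> 4"
      by (simp add: abs_mult flip: right_diff_distrib)
    then show ?thesis by (simp add: pos_le_divide_eq mult.commute)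
  qed
  then show ?thesis using s(1) by blast
qed

section \<open>Recovering points of the space by completeness\<close>

definition finitely_supported_maps :: "'a::uniform_space set \<Rightarrow> ('a \<Rightarrow> nat \<Rightarrow> real) set" where
  "finitely_supported_maps S = {f. (\<forall>x k. 0 \<le> f x k) \<and> (\<forall>x\<in>S. finite {k. f x k \<noteq> 0}) \<and>
     (\<forall>e>0. eventually (\<lambda>(x, y). \<forall>k. \<bar>f x k - f y k\<bar> < e) uniformity)}"

lemma finitely_supported_maps_separate:
  fixes S :: "'a::uniform_space set"
  assumes "separable_space (top_of_set S)" "eventually E uniformity"
  obtains f \<epsilon> where "f \<in> finitely_supported_maps S" "0 < \<epsilon>"
    "\<And>x y. x \<in> S \<Longrightarrow> (\<And>k. \<bar>f x k - f y k\<bar> < \<epsilon>) \<Longrightarrow> E (x, y)"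
proof (rule separable_finitely_supported_map[OF assms])
  fix f :: "'a \<Rightarrow> nat \<Rightarrow> real" and \<epsilon> :: real
  assume "\<And>x k. 0 \<le> f x k" "\<And>x. x \<in> S \<Longrightarrow> finite {k. f x k \<noteq> 0}"
    "\<And>e. 0 < e \<Longrightarrow> eventually (\<lambda>(x, y). \<forall>k. \<bar>f x k - f y k\<bar> < e) uniformity"
    "0 < \<epsilon>" "\<And>x y. x \<in> S \<Longrightarrow> (\<And>k. \<bar>f x k - f y k\<bar> < \<epsilon>) \<Longrightarrow> E (x, y)"
  then show thesis by (intro that[of f \<epsilon>]) (auto simp: finitely_supported_maps_def)
qed

text \<open>The sets of points that match \<open>\<tau>\<close> on finitely many maps up to
  \<open>4 / 2 ^ n\<close> form a filter base. It is Cauchy because each entourage is controlled by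
  a single map, and continuity of the maps identifies their values at the limit.\<close>

lemma complete_common_value:
  fixes S :: "'a::uniform_space set"
  assumes sep: "separable_space (top_of_set S)" and compl: "complete S"
    and approx: "\<And>F n. finite F \<Longrightarrow> F \<subseteq> finitely_supported_maps S \<Longrightarrow>
      \<exists>s\<in>S. \<forall>f\<in>F. \<forall>k. \<bar>\<tau> f k - f s k\<bar> \<le> 4 / 2 ^ n"
  shows "\<exists>s\<in>S. \<forall>f\<in>finitely_supported_maps S. \<forall>k. f s k = \<tau> f k"
proof -
  let ?I = "{F. finite F \<and> F \<subseteq> finitely_supported_maps S} \<times> (UNIV :: nat set)"
  define B where "B i = {s\<in>S. \<forall>f\<in>fst i. \<forall>k. \<bar>\<tau> f k - f s k\<bar> \<le> 4 / 2 ^ snd i}"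
    for i :: "('a \<Rightarrow> nat \<Rightarrow> real) set \<times> nat"
  define \<F> where "\<F> = (INF i\<in>?I. principal (B i))"
  have ev: "eventually P \<F> \<longleftrightarrow> (\<exists>i\<in>?I. \<forall>s\<in>B i. P s)" for P
  proof -
    have "eventually P \<F> \<longleftrightarrow> (\<exists>i\<in>?I. eventually P (principal (B i)))"
      unfolding \<F>_def
    proof (rule eventually_INF_base)
      show "?I \<noteq> {}" by auto
      fix i j assume ij: "i \<in> ?I" "j \<in> ?I"
      let ?k = "(fst i \<union> fst j, max (snd i) (snd j))"
      have "B ?k \<subseteq> B l" if "l = i \<or> l = j" for l
      proof
        fix s assume s: "s \<in> B ?k"
        have l: "fst l \<subseteq> fst ?k" "(4 :: real) / 2 ^ snd ?k \<le> 4 / 2 ^ snd l"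
          using that by (auto intro!: divide_left_mono power_increasing)
        have "\<bar>\<tau> f k - f s k\<bar> \<le> 4 / 2 ^ snd l" if "f \<in> fst l" for f k
        proof -
          have "\<bar>\<tau> f k - f s k\<bar> \<le> 4 / 2 ^ snd ?k" using s that l(1) unfolding B_def by blast
          then show ?thesis using l(2) by linarith
        qed
        then show "s \<in> B l" using s unfolding B_def by blast
      qed
      then show "\<exists>k\<in>?I. principal (B k) \<le> inf (principal (B i)) (principal (B j))"
        using ij by (intro bexI[of _ ?k]) auto
    qed
    then show ?thesis by (simp add: eventually_principal)
  qed
  have "\<F> \<noteq> bot"
  proof
    assume "\<F> = bot"
    then have "eventually (\<lambda>_. False) \<F>" by simp
    then obtain i where i: "i \<in> ?I" "B i = {}" unfolding ev by blast
    then have "finite (fst i)" "fst i \<subseteq> finitely_supported_maps S" by auto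
    from approx[OF this, of "snd i"] show False using i(2) by (auto simp: B_def)
  qed
  \<comment> \<open>With no maps prescribed, the base set is \<open>S\<close> itself.\<close>
  have "\<F> \<le> principal S"
    unfolding le_principal ev by (intro bexI[of _ "({}, 0)"]) (auto simp: B_def)
  have "cauchy_filter \<F>"
    unfolding cauchy_filter_def le_filter_def
  proof (intro allI impI)
    fix E :: "'a \<times> 'a \<Rightarrow> bool" assume "eventually E uniformity"
    then obtain f \<epsilon> where f: "f \<in> finitely_supported_maps S" "0 < \<epsilon>"
      "\<And>x y. x \<in> S \<Longrightarrow> (\<And>k. \<bar>f x k - f y k\<bar> < \<epsilon>) \<Longrightarrow> E (x, y)"
      using finitely_supported_maps_separate[OF sep] by metis
    \<comment> \<open>Two points of the base set are both within \<open>4 / 2 ^ n\<close> of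
      \<open>\<tau>\<close>, so this bound has to be below \<open>\<epsilon> / 2\<close>.\<close>
    obtain n where "(1/2) ^ n < \<epsilon> / 8" using real_arch_pow_inv[of "\<epsilon> / 8" "1/2"] f(2) by auto
    then have n: "4 / 2 ^ n < \<epsilon> / 2" by (simp add: power_divide)
    have "E (x, y)" if "x \<in> B ({f}, n)" "y \<in> B ({f}, n)" for x y
    proof (rule f(3))
      show "x \<in> S" using that by (simp add: B_def)
      show "\<bar>f x k - f y k\<bar> < \<epsilon>" for k
      proof -
        have "\<bar>\<tau> f k - f x k\<bar> \<le> 4 / 2 ^ n" "\<bar>\<tau> f k - f y k\<bar> \<le> 4 / 2 ^ n"
          using that by (simp_all add: B_def)
        then show ?thesis using n by linarith
      qed
    qed
    moreover have "eventually (\<lambda>x. x \<in> B ({f}, n)) \<F>"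
      unfolding ev using f(1) by (intro bexI[of _ "({f}, n)"]) auto
    ultimately show "eventually E (\<F> \<times>\<^sub>F \<F>)"
      unfolding eventually_prod_same by blast
  qed
  then obtain s where s: "s \<in> S" "\<F> \<le> nhds s"
    using compl \<open>\<F> \<noteq> bot\<close> \<open>\<F> \<le> principal S\<close> unfolding complete_uniform by blast
  have "f s k = \<tau> f k" if f: "f \<in> finitely_supported_maps S" for f k
  proof -
    have "\<bar>f s k - \<tau> f k\<bar> \<le> e" if "0 < e" for e
    proof -
      have "eventually (\<lambda>(x, y). \<forall>k. \<bar>f x k - f y k\<bar> < e / 2) uniformity"
        using f half_gt_zero[OF \<open>0 < e\<close>] unfolding finitely_supported_maps_def by blast
      then have "eventually (\<lambda>y. \<forall>k. \<bar>f s k - f y k\<bar> < e / 2) (nhds s)"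
        unfolding eventually_nhds_uniformity by (rule eventually_mono) auto
      then have 1: "eventually (\<lambda>y. \<forall>k. \<bar>f s k - f y k\<bar> < e / 2) \<F>"
        using s(2) by (rule filter_leD[rotated])
      obtain n where "(1/2) ^ n < e / 8" using real_arch_pow_inv[of "e / 8" "1/2"] \<open>0 < e\<close> by auto
      then have n: "4 / 2 ^ n < e / 2" by (simp add: power_divide)
      have 2: "eventually (\<lambda>y. y \<in> B ({f}, n)) \<F>"
        unfolding ev using f(1) by (intro bexI[of _ "({f}, n)"]) auto
      obtain y where y: "\<forall>k. \<bar>f s k - f y k\<bar> < e / 2" "y \<in> B ({f}, n)"
        using eventually_happens[OF eventually_conj[OF 1 2]] \<open>\<F> \<noteq> bot\<close> by blast
      then have "\<bar>f s k - f y k\<bar> < e / 2" "\<bar>\<tau> f k - f y k\<bar> \<le> 4 / 2 ^ n" by (auto simp: B_def)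
      then show ?thesis using n by linarith
    qed
    then have "\<bar>f s k - \<tau> f k\<bar> \<le> 0"
      using field_le_epsilon[of "\<bar>f s k - \<tau> f k\<bar>" 0] by simp
    then show ?thesis by simp
  qed
  then show ?thesis using s(1) by blast
qed

section \<open>The inverse spectrum\<close>

theorem theorem9p5:
  fixes S :: "'a::{uniform_space, t2_space} set"
  assumes "separable_space (top_of_set S)" and "complete S"
  shows "\<exists>(I :: (('a \<Rightarrow> nat \<Rightarrow> real) set \<times> nat) set) R
           (K :: ('a \<Rightarrow> nat \<Rightarrow> real) set \<times> nat \<Rightarrow> (nat \<Rightarrow>\<^sub>C real) set) p.
           inverse_spectrum I R K p \<and>
           (\<forall>i\<in>I. uniform_polyhedron (K i)) \<and>
           uniformly_homeomorphic S (uniformity_on S)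
             (spectrum_limit I R K p) (spectrum_limit_uniformity I R K p)"
proof -
  let ?M = "finitely_supported_maps S"
  define I where "I = {F. finite F \<and> F \<subseteq> ?M} \<times> (UNIV :: nat set)"
  define R where "R = {(i, j). i \<in> I \<and> j \<in> I \<and> fst i \<subseteq> fst j \<and> snd i \<le> snd j}"
  define N where "N i = cubical_nbhd S (fst i) (snd i)" for i
  have R_iff: "(i, j) \<in> R \<longleftrightarrow> i \<in> I \<and> j \<in> I \<and> fst i \<subseteq> fst j \<and> snd i \<le> snd j" for i j
    by (simp add: R_def)
  have fin: "finite (fst i)" and sub: "fst i \<subseteq> ?M" if "i \<in> I" for i
    using that by (auto simp: I_def)
  \<comment> \<open>The properties of a realization are bundled so that a single choice supplies
    \<open>K\<close> and \<open>\<rho>\<close> for all indices.\<close>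
  define Q where "Q i K \<rho> \<longleftrightarrow> uniform_polyhedron K \<and> bij_betw \<rho> (N i) K \<and>
    (\<forall>x\<in>N i. \<forall>y\<in>N i. \<forall>\<delta>. (\<forall>c. \<bar>x c - y c\<bar> \<le> \<delta>) \<longrightarrow> dist (\<rho> x) (\<rho> y) \<le> 2 ^ snd i * \<delta>) \<and>
    (\<forall>x\<in>N i. \<forall>y\<in>N i. dist (\<rho> x) (\<rho> y) < 1/2 \<longrightarrow> (\<forall>c. \<bar>x c - y c\<bar> \<le> 3 * dist (\<rho> x) (\<rho> y)))"
    for i and K :: "(nat \<Rightarrow>\<^sub>C real) set" and \<rho>
  have "\<forall>i\<in>I. \<exists>K \<rho>. Q i K \<rho>"
    unfolding Q_def N_def by (intro ballI cubical_nbhd_polyhedron fin)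
  then obtain K \<rho> where K\<rho>: "\<And>i. i \<in> I \<Longrightarrow> Q i (K i) (\<rho> i)" by metis
  have poly: "uniform_polyhedron (K i)" and bij: "bij_betw (\<rho> i) (N i) (K i)" if "i \<in> I" for i
    using K\<rho>[OF that] by (simp_all add: Q_def)
  have upper: "dist (\<rho> i x) (\<rho> i y) \<le> 2 ^ snd i * \<delta>"
    if "i \<in> I" "x \<in> N i" "y \<in> N i" "\<And>c. \<bar>x c - y c\<bar> \<le> \<delta>" for i x y \<delta>
    using K\<rho>[OF that(1)] that(2-4) unfolding Q_def by blast
  have lower: "\<bar>x c - y c\<bar> \<le> 3 * dist (\<rho> i x) (\<rho> i y)"
    if "i \<in> I" "x \<in> N i" "y \<in> N i" "dist (\<rho> i x) (\<rho> i y) < 1/2" for i x y c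
    using K\<rho>[OF that(1)] that(2-4) unfolding Q_def by blast
  define \<sigma> where "\<sigma> i = inv_into (N i) (\<rho> i)" for i
  have \<rho>_K: "\<rho> i x \<in> K i" and \<sigma>\<rho>: "\<sigma> i (\<rho> i x) = x" if "i \<in> I" "x \<in> N i" for i x
    using bij[OF that(1)] that(2) unfolding \<sigma>_def bij_betw_def by auto
  have \<sigma>_N: "\<sigma> i y \<in> N i" and \<rho>\<sigma>: "\<rho> i (\<sigma> i y) = y" if "i \<in> I" "y \<in> K i" for i y
    using that(2) bij_betw_inv_into_right[OF bij[OF that(1)]]
      bij_betwE[OF bij_betw_inv_into[OF bij[OF that(1)]]] unfolding \<sigma>_def by blast+
  define p where "p i j y = \<rho> i (restrict_coords (fst i) (\<sigma> j y))" for i j y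
  have restr_N: "restrict_coords (fst i) x \<in> N i" if "(i, j) \<in> R" "x \<in> N j" for i j x
    using that restrict_coords_mem_nbhd unfolding N_def R_iff by blast
  have p_\<rho>: "p i j (\<rho> j x) = \<rho> i (restrict_coords (fst i) x)" if "(i, j) \<in> R" "x \<in> N j" for i j x
    using that \<sigma>\<rho> by (simp add: p_def R_iff)

  have spectrum: "inverse_spectrum I R K p"
    unfolding inverse_spectrum_def
  proof (intro conjI)
    show "directed_set I R"
      unfolding directed_set_def
    proof (intro conjI ballI)
      show "I \<noteq> {}" by (auto simp: I_def)
      show "preorder_on I R"
        unfolding preorder_on_def by (auto simp: refl_on_def R_iff intro!: transI) blast
      show "\<exists>k\<in>I. (i, k) \<in> R \<and> (j, k) \<in> R" if "i \<in> I" "j \<in> I" for i j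
        using that by (intro bexI[of _ "(fst i \<union> fst j, max (snd i) (snd j))"]) (auto simp: R_iff I_def)
    qed
    show "\<forall>(i, j)\<in>R. p i j \<in> K j \<rightarrow> K i \<and> uniformly_continuous_on (K j) (p i j)"
    proof (intro ballI, clarify, intro conjI)
      fix F n G m assume "((F, n), (G, m)) \<in> R"
      then obtain i j where ij: "i = (F, n)" "j = (G, m)" "(i, j) \<in> R" by blast
      then have I: "i \<in> I" "j \<in> I" by (simp_all add: R_iff)
      have "p i j \<in> K j \<rightarrow> K i"
        using \<rho>_K[OF I(1) restr_N[OF ij(3)]] \<sigma>_N[OF I(2)] by (auto simp: p_def)
      then show "p (F, n) (G, m) \<in> K (G, m) \<rightarrow> K (F, n)" using ij by simp
      have "uniformly_continuous_on (K j) (p i j)"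
        unfolding uniformly_continuous_on_def
      proof (intro allI impI)
        fix e :: real assume e: "0 < e"
        \<comment> \<open>\<open>lower\<close> needs distance below 1/2 and costs a factor 3;
          \<open>upper\<close> costs \<open>2 ^ snd i\<close>.\<close>
        define d where "d = min (1/2) (e / (3 * 2 ^ snd i))"
        have "0 < d" using e by (simp add: d_def)
        moreover have "dist (p i j y') (p i j y) < e"
          if y: "y \<in> K j" "y' \<in> K j" "dist y' y < d" for y y'
        proof -
          have N: "\<sigma> j y \<in> N j" "\<sigma> j y' \<in> N j" using \<sigma>_N[OF I(2)] y by blast+
          have "dist (\<rho> j (\<sigma> j y')) (\<rho> j (\<sigma> j y)) < 1/2"
            using y \<rho>\<sigma>[OF I(2)] by (simp add: d_def)
          from lower[OF I(2) N(2,1) this] have "\<bar>\<sigma> j y' c - \<sigma> j y c\<bar> \<le> 3 * dist y' y" for c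
            using \<rho>\<sigma>[OF I(2)] y by simp
          then have "\<bar>restrict_coords (fst i) (\<sigma> j y') c - restrict_coords (fst i) (\<sigma> j y) c\<bar> \<le> 3 * dist y' y" for c
            by (simp add: restrict_coords_def)
          from upper[OF I(1) restr_N[OF ij(3) N(2)] restr_N[OF ij(3) N(1)] this]
          have "dist (p i j y') (p i j y) \<le> 2 ^ snd i * (3 * dist y' y)"
            by (simp add: p_def)
          also have "\<dots> < e" using y(3) by (simp add: d_def pos_less_divide_eq algebra_simps)
          finally show ?thesis .
        qed
        ultimately show "\<exists>d>0. \<forall>y\<in>K j. \<forall>y'\<in>K j. dist y' y < d \<longrightarrow> dist (p i j y') (p i j y) < e" by blast
      qed
      then show "uniformly_continuous_on (K (G, m)) (p (F, n) (G, m))" using ij by simp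
    qed
    show "\<forall>i\<in>I. \<forall>x\<in>K i. p i i x = x"
    proof (intro ballI)
      fix i x assume "i \<in> I" "x \<in> K i"
      then show "p i i x = x"
        using restrict_coords_nbhd \<sigma>_N \<rho>\<sigma> unfolding p_def N_def by metis
    qed
    show "\<forall>i j k. (i, j) \<in> R \<and> (j, k) \<in> R \<longrightarrow> (\<forall>x\<in>K k. p i j (p j k x) = p i k x)"
    proof (intro allI impI ballI, elim conjE)
      fix i j k x assume ijk: "x \<in> K k" "(i, j) \<in> R" "(j, k) \<in> R"
      then have "\<sigma> k x \<in> N k" using \<sigma>_N by (simp add: R_iff)
      from restr_N[OF ijk(3) this] show "p i j (p j k x) = p i k x"
        using p_\<rho>[OF ijk(2)] ijk(2) unfolding p_def[of j k] p_def[of i k]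
        by (simp add: restrict_coords_restrict R_iff)
    qed
  qed

  let ?L = "spectrum_limit I R K p" and ?U = "spectrum_limit_uniformity I R K p"
  define h where "h i s = \<rho> i (evaluate (fst i) s)" for i s
  have ev_N: "evaluate (fst i) s \<in> N i" if "i \<in> I" "s \<in> S" for i s
    unfolding N_def
  proof (rule evaluate_mem_nbhd[OF fin[OF that(1)] that(2)])
    show "0 \<le> f s k" "finite {k. f s k \<noteq> 0}" if "f \<in> fst i" for f k
      using that sub[OF \<open>i \<in> I\<close>] \<open>s \<in> S\<close> by (auto simp: finitely_supported_maps_def)
  qed
  have h_map: "uniform_map S (uniformity_on S) (K i) (uniformity_on (K i)) (h i)" if i: "i \<in> I" for i
    unfolding uniform_map_def
  proof
    show hK: "h i \<in> S \<rightarrow> K i" using \<rho>_K[OF i ev_N[OF i]] by (simp add: h_def)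
    have "uniformly_continuous_on S (h i)"
      unfolding uniformly_continuous_on_uniformity filterlim_iff
    proof (intro allI impI)
      fix P :: "(nat \<Rightarrow>\<^sub>C real) \<times> (nat \<Rightarrow>\<^sub>C real) \<Rightarrow> bool" assume "eventually P uniformity"
      then obtain e where e: "0 < e" "\<And>x y. dist x y < e \<Longrightarrow> P (x, y)"
        unfolding eventually_uniformity_metric by blast
      \<comment> \<open>The extra 2 makes up for \<open>upper\<close> being a non-strict
        estimate.\<close>
      define d where "d = e / (2 * 2 ^ snd i)"
      have d: "0 < d" "2 ^ snd i * d < e" using e(1) by (simp_all add: d_def)
      have "eventually (\<lambda>z. \<forall>f\<in>fst i. \<forall>k. \<bar>f (fst z) k - f (snd z) k\<bar> < d) uniformity"
        using sub[OF i] d(1)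
        by (intro eventually_ball_finite fin[OF i])
           (auto simp: finitely_supported_maps_def case_prod_unfold)
      then have "eventually (\<lambda>z. fst z \<in> S \<longrightarrow> snd z \<in> S \<longrightarrow> P (h i (fst z), h i (snd z))) uniformity"
      proof (rule eventually_mono, intro impI)
        fix z :: "'a \<times> 'a"
        assume z: "\<forall>f\<in>fst i. \<forall>k. \<bar>f (fst z) k - f (snd z) k\<bar> < d" "fst z \<in> S" "snd z \<in> S"
        have "\<bar>evaluate (fst i) (fst z) c - evaluate (fst i) (snd z) c\<bar> \<le> d" for c
          using z(1) d(1) by (auto simp: evaluate_def less_imp_le)
        from upper[OF i ev_N[OF i z(2)] ev_N[OF i z(3)] this]
        show "P (h i (fst z), h i (snd z))" using d(2) unfolding h_def by (intro e(2)) linarith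
      qed
      then show "eventually (\<lambda>z. P (case z of (x, y) \<Rightarrow> (h i x, h i y))) (uniformity_on S)"
        unfolding eventually_inf_principal by (simp add: case_prod_unfold mem_Times_iff imp_conjL)
    qed
    moreover have "eventually (\<lambda>z. (h i (fst z), h i (snd z)) \<in> K i \<times> K i) (uniformity_on S)"
      unfolding eventually_inf_principal using hK by (intro always_eventually) auto
    ultimately show "LIM (x, y) uniformity_on S. (h i x, h i y) :> uniformity_on (K i)"
      unfolding uniformly_continuous_on_uniformity filterlim_inf filterlim_principal case_prod_unfold
      by blast
  qed
  have compat: "p i j (h j s) = h i s" if "(i, j) \<in> R" "s \<in> S" for i j s
    using that p_\<rho>[OF that(1) ev_N] by (simp add: h_def R_iff restrict_coords_evaluate)
  define \<Phi> where "\<Phi> s = (\<lambda>i\<in>I. h i s)" for s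
  have R_sub: "R \<subseteq> I \<times> I" by (auto simp: R_iff)
  have \<Phi>_map: "uniform_map S (uniformity_on S) ?L ?U \<Phi>"
    unfolding \<Phi>_def
    by (rule spectrum_limit_universal(1)[OF _ R_sub h_map compat]) simp_all

  have onto: "\<exists>s\<in>S. \<Phi> s = x" if x: "x \<in> ?L" for x
  proof -
    have xK: "x i \<in> K i" if "i \<in> I" for i using x that by (auto simp: spectrum_limit_def)
    define t where "t i = \<sigma> i (x i)" for i
    have tN: "t i \<in> N i" and \<rho>t: "\<rho> i (t i) = x i" if "i \<in> I" for i
      using \<sigma>_N \<rho>\<sigma> xK that by (simp_all add: t_def)
    have t_restr: "t i = restrict_coords (fst i) (t j)" if ij: "(i, j) \<in> R" for i j
    proof -
      have j: "i \<in> I" "j \<in> I" using ij by (simp_all add: R_iff)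
      have "p i j (x j) = x i" using spectrum_limit_projection_compatible[OF x ij] .
      then have "x i = \<rho> i (restrict_coords (fst i) (t j))"
        using p_\<rho>[OF ij tN[OF j(2)]] \<rho>t[OF j(2)] by simp
      then show ?thesis using \<sigma>\<rho>[OF j(1) restr_N[OF ij tN[OF j(2)]]] by (simp add: t_def)
    qed
    \<comment> \<open>The value belonging to \<open>f\<close> is read off at the smallest index
      containing \<open>f\<close>; compatibility of the thread makes it the value at every index
      containing \<open>f\<close>. The approximation is therefore available at every mesh for the
      same \<open>\<tau>\<close>.\<close>
    define \<tau> where "\<tau> f k = t ({f}, 0) (f, k)" for f k
    have t_\<tau>: "t i (f, k) = \<tau> f k" if "i \<in> I" "f \<in> fst i" for i f k
    proof -
      have "(({f}, 0), i) \<in> R" using that sub by (auto simp: R_iff I_def)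
      from t_restr[OF this] show ?thesis by (simp add: \<tau>_def restrict_coords_def)
    qed
    have "\<exists>s\<in>S. \<forall>f\<in>?M. \<forall>k. f s k = \<tau> f k"
    proof (rule complete_common_value[OF assms])
      fix F n assume F: "finite F" "F \<subseteq> ?M"
      then have i: "(F, n) \<in> I" by (simp add: I_def)
      show "\<exists>s\<in>S. \<forall>f\<in>F. \<forall>k. \<bar>\<tau> f k - f s k\<bar> \<le> 4 / 2 ^ n"
        using cubical_nbhd_approx[OF tN[OF i, unfolded N_def fst_conv snd_conv]] t_\<tau>[OF i] by simp
    qed
    then obtain s where s: "s \<in> S" "\<forall>f\<in>?M. \<forall>k. f s k = \<tau> f k" by blast
    have "h i s = x i" if i: "i \<in> I" for i
    proof -
      have "evaluate (fst i) s c = restrict_coords (fst i) (t i) c" for c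
        using s(2) t_\<tau>[OF i] sub[OF i] by (cases c) (auto simp: evaluate_def restrict_coords_def)
      then have "evaluate (fst i) s = t i"
        using restrict_coords_nbhd[OF tN[OF i, unfolded N_def]] by (metis ext)
      then show ?thesis using \<rho>t[OF i] by (simp add: h_def)
    qed
    moreover have "x \<in> extensional I" using x by (auto simp: spectrum_limit_def PiE_def)
    ultimately have "\<Phi> s = x" by (auto simp: \<Phi>_def fun_eq_iff extensional_def)
    then show ?thesis using s(1) by blast
  qed

  \<comment> \<open>Each entourage of \<open>S\<close> is detected by one map, and mesh level 0 is
    enough because the constant in \<open>lower\<close> does not depend on the level. Both
    injectivity and uniform continuity of the inverse follow from this.\<close>
  have separate: "\<exists>i\<in>I. \<exists>\<delta>>0. \<forall>s\<in>S. \<forall>s'\<in>S. dist (h i s) (h i s') < \<delta> \<longrightarrow> E (s, s')"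
    if E: "eventually E uniformity" for E :: "'a \<times> 'a \<Rightarrow> bool"
  proof -
    obtain f \<epsilon> where f: "f \<in> ?M" "0 < \<epsilon>"
      "\<And>x y. x \<in> S \<Longrightarrow> (\<And>k. \<bar>f x k - f y k\<bar> < \<epsilon>) \<Longrightarrow> E (x, y)"
      using finitely_supported_maps_separate[OF assms(1) E] by metis
    let ?i = "({f}, 0 :: nat)"
    have i: "?i \<in> I" using f(1) by (simp add: I_def)
    have "E (s, s')" if s: "s \<in> S" "s' \<in> S" and d: "dist (h ?i s) (h ?i s') < min (1/2) (\<epsilon> / 3)" for s s'
    proof (rule f(3)[OF s(1)])
      fix k
      have "dist (\<rho> ?i (evaluate (fst ?i) s)) (\<rho> ?i (evaluate (fst ?i) s')) < 1/2"
        using d by (simp add: h_def)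
      from lower[OF i ev_N[OF i s(1)] ev_N[OF i s(2)] this, of "(f, k)"]
      show "\<bar>f s k - f s' k\<bar> < \<epsilon>" using d by (simp add: h_def evaluate_def)
    qed
    moreover have "0 < min (1/2) (\<epsilon> / 3)" using f(2) by simp
    ultimately show ?thesis using i by blast
  qed
  have inj: "s = s'" if s: "s \<in> S" "s' \<in> S" "\<Phi> s = \<Phi> s'" for s s'
  proof (rule ccontr)
    assume "s \<noteq> s'"
    \<comment> \<open>The Hausdorff hypothesis enters here: an open set containing only the first
      point yields an entourage that separates the two.\<close>
    then obtain U where U: "open U" "s \<in> U" "s' \<notin> U" using t1_space by blast
    then have "eventually (\<lambda>(x, y). x = s \<longrightarrow> y \<in> U) uniformity"
      unfolding open_uniformity by blast
    from separate[OF this] obtain i \<delta> where i: "i \<in> I" "0 < \<delta>"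
      "\<forall>s1\<in>S. \<forall>s2\<in>S. dist (h i s1) (h i s2) < \<delta> \<longrightarrow> s1 = s \<longrightarrow> s2 \<in> U" by auto
    have "h i s = h i s'" using fun_cong[OF s(3), of i] i(1) by (simp add: \<Phi>_def)
    then show False using i s U(3) by simp
  qed
  define g where "g x = (THE s. s \<in> S \<and> \<Phi> s = x)" for x
  have g: "g x \<in> S" "\<Phi> (g x) = x" if "x \<in> ?L" for x
  proof -
    have "\<exists>!s. s \<in> S \<and> \<Phi> s = x" using onto[OF that] inj by blast
    from theI'[OF this] show "g x \<in> S" "\<Phi> (g x) = x" unfolding g_def by blast+
  qed
  have g_map: "uniform_map ?L ?U S (uniformity_on S) g"
    unfolding uniform_map_def
  proof
    show gS: "g \<in> ?L \<rightarrow> S" using g by blast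
    have U_L: "eventually (\<lambda>z. z \<in> ?L \<times> ?L) ?U"
      unfolding spectrum_limit_uniformity_def by (intro filter_leD[OF inf_le2]) (simp add: eventually_principal)
    have "LIM z ?U. (g (fst z), g (snd z)) :> uniformity"
      unfolding filterlim_iff
    proof (intro allI impI)
      fix E :: "'a \<times> 'a \<Rightarrow> bool" assume "eventually E uniformity"
      from separate[OF this] obtain i \<delta> where i: "i \<in> I" "0 < \<delta>"
        "\<forall>s\<in>S. \<forall>s'\<in>S. dist (h i s) (h i s') < \<delta> \<longrightarrow> E (s, s')" by blast
      \<comment> \<open>Closeness in the single coordinate \<open>i\<close> is an entourage of the
        limit, so \<open>separate\<close> turns the uniform continuity of one projection into that
        of \<open>g\<close>.\<close>
      have "LIM (x, y) ?U. (x i, y i) :> uniformity_on (K i)"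
        using spectrum_limit_projection[OF i(1), of R K p] by (simp add: uniform_map_def)
      then have lim: "LIM (x, y) ?U. (x i, y i) :> uniformity"
        by (rule filterlim_mono) simp_all
      have "eventually (\<lambda>(a, b). dist a b < \<delta>) (uniformity :: ((nat \<Rightarrow>\<^sub>C real) \<times> (nat \<Rightarrow>\<^sub>C real)) filter)"
        unfolding eventually_uniformity_metric using i(2) by auto
      from eventually_compose_filterlim[OF this lim]
      have "eventually (\<lambda>z. dist (fst z i) (snd z i) < \<delta>) ?U" by (simp add: case_prod_unfold)
      with U_L show "eventually (\<lambda>z. E (g (fst z), g (snd z))) ?U"
      proof eventually_elim
        case (elim z)
        have "h i (g y) = y i" if "y \<in> ?L" for y
          using fun_cong[OF g(2)[OF that], of i] i(1) by (simp add: \<Phi>_def)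
        then show ?case using elim i(3) g(1) by (auto simp: mem_Times_iff)
      qed
    qed
    moreover have "eventually (\<lambda>z. (g (fst z), g (snd z)) \<in> S \<times> S) ?U"
      using U_L by eventually_elim (use g in auto)
    ultimately show "LIM (x, y) ?U. (g x, g y) :> uniformity_on S"
      unfolding filterlim_inf filterlim_principal case_prod_unfold by blast
  qed
  have "g (\<Phi> s) = s" if "s \<in> S" for s
  proof -
    have "\<Phi> s \<in> ?L" using \<Phi>_map that by (auto simp: uniform_map_def)
    then show ?thesis using g inj that by blast
  qed
  then have "uniformly_homeomorphic S (uniformity_on S) ?L ?U"
    unfolding uniformly_homeomorphic_def using \<Phi>_map g_map g(2) by blast
  then show ?thesis using spectrum poly by blast
qed

end
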